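(* The following hold, where all counts are the exact numbers of codes up to equivalence. (i) There are $2$ inequivalent ternary optimal LCD $[4s,2]$ codes with dual distances $d^\perp\ge 2$ for every integer $s\ge 1$. (ii) Suppose that $t\in\{1,2\}$. Then there is a unique ternary optimal LCD $[4s+t,2]$ code with dual distance $d^\perp\ge 2$, up to equivalence, for every integer $s\ge 1$. (iii) There are $3$ inequivalent ternary optimal LCD $[4s+3,2]$ codes with dual distances $d^\perp\ge 2$ for every integer $s\ge 2$.
   Context: A ternary $[n,k]$ code is a $k$-dimensional subspace $C$ of $\mathbb{F}_3^n$; an $[n,k,d]$ code is one whose minimum weight (the smallest Hamming weight of a nonzero codeword) is exactly $d$. The dual code is $C^\perp=\{x\in\mathbb{F}_3^n: x\cdot y=0 \text{ for all } y\in C\}$ for the standard inner product. $C$ is LCD (linear complementary dual) if $C\cap C^\perp=\{0\}$. The dual distance $d^\perp$ of $C$ is the minimum weight of $C^\perp$. Two ternary $[n,k]$ codes $C_1,C_2$ are equivalent if $C_2=\{cP: c\in C_1\}$ for some $n\times n$ monomial matrix $P$ over $\mathbb{F}_3$. Let $d_3(n,k)$ be the largest $d$ such that a ternary LCD $[n,k,d]$ code exists; an LCD $[n,k,d_3(n,k)]$ code is called optimal. (One has, for $n\ge 2$, $d_3(n,2)=\lfloor 3n/4\rfloor$ if $n\equiv 1,2\pmod 4$ and $d_3(n,2)=\lfloor 3n/4\rfloor-1$ if $n\equiv 0,3\pmod 4$.) *)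

theory Defs
  imports "Jordan_Normal_Form.VS_Connect"
begin

text \<open>The three-element type of \<^theory>\<open>HOL.Enum\<close>, with its \<^class>\<open>field\<close> instance, serves as
  the field of order 3. Words of length n are the vectors in \<open>carrier_vec n\<close>.\<close>

type_synonym F3 = Enum.finite_3

definition hamming_weight :: "F3 vec \<Rightarrow> nat" where
  "hamming_weight v = card {i. i < dim_vec v \<and> v $ i \<noteq> 0}"

definition linear_code :: "nat \<Rightarrow> nat \<Rightarrow> F3 vec set \<Rightarrow> bool" where
  "linear_code n k C \<longleftrightarrow>
     subspace class_ring C (module_vec TYPE(F3) n) \<and>
     vectorspace.dim class_ring ((module_vec TYPE(F3) n)\<lparr>carrier := C\<rparr>) = k"

text \<open>As a minimum over a finite set, this is only meaningful if \<open>C\<close> has a nonzero word.\<close>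

definition min_weight :: "nat \<Rightarrow> F3 vec set \<Rightarrow> nat" where
  "min_weight n C = Min (hamming_weight ` (C - {0\<^sub>v n}))"

definition linear_code_dist :: "nat \<Rightarrow> nat \<Rightarrow> nat \<Rightarrow> F3 vec set \<Rightarrow> bool" where
  "linear_code_dist n k d C \<longleftrightarrow> linear_code n k C \<and> min_weight n C = d"

definition dual_code :: "nat \<Rightarrow> F3 vec set \<Rightarrow> F3 vec set" where
  "dual_code n C = {x \<in> carrier_vec n. \<forall>y\<in>C. x \<bullet> y = 0}"

definition dual_distance :: "nat \<Rightarrow> F3 vec set \<Rightarrow> nat" where
  "dual_distance n C = min_weight n (dual_code n C)"

definition LCD :: "nat \<Rightarrow> F3 vec set \<Rightarrow> bool" where
  "LCD n C \<longleftrightarrow> C \<inter> dual_code n C = {0\<^sub>v n}"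

definition d3 :: "nat \<Rightarrow> nat \<Rightarrow> nat" where
  "d3 n k = Max {d. \<exists>C. linear_code_dist n k d C \<and> LCD n C}"

definition optimal_LCD :: "nat \<Rightarrow> nat \<Rightarrow> F3 vec set \<Rightarrow> bool" where
  "optimal_LCD n k C \<longleftrightarrow> linear_code_dist n k (d3 n k) C \<and> LCD n C"

definition monomial_mat :: "nat \<Rightarrow> F3 mat \<Rightarrow> bool" where
  "monomial_mat n P \<longleftrightarrow> P \<in> carrier_mat n n \<and>
     (\<forall>i<n. \<exists>!j. j < n \<and> P $$ (i, j) \<noteq> 0) \<and>
     (\<forall>j<n. \<exists>!i. i < n \<and> P $$ (i, j) \<noteq> 0)"

text \<open>The row vector \<open>c P\<close> is the vector \<open>transpose_mat P *\<^sub>v c\<close>.\<close>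

definition code_equiv :: "nat \<Rightarrow> (F3 vec set \<times> F3 vec set) set" where
  "code_equiv n = {(C\<^sub>1, C\<^sub>2). C\<^sub>1 \<subseteq> carrier_vec n \<and>
     (\<exists>P. monomial_mat n P \<and> C\<^sub>2 = {transpose_mat P *\<^sub>v c | c. c \<in> C\<^sub>1})}"

text \<open>The number of pairwise inequivalent codes in a family \<open>X\<close> of codes of length n that is closed
  under equivalence.\<close>

definition num_inequivalent :: "nat \<Rightarrow> F3 vec set set \<Rightarrow> nat" where
  "num_inequivalent n X = card (X // code_equiv n)"

end

theory Submission
  imports Defs "HOL-Combinatorics.Permutations"
begin

text \<open>
  A two-dimensional code \<open>span2 u v\<close> has, up to sign, exactly four nonzero words: \<open>u\<close>, \<open>v\<close>, \<open>u + v\<close>, \<open>u - v\<close>.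
  Their weights decide everything asked about the code.

  \<^item> A coordinate at which \<open>u\<close> and \<open>v\<close> do not both vanish is zero in exactly one of the four words
    (\<open>hamming_weight_sum_four\<close>). So the four weights add up to three times the number of such
    coordinates, and dual distance at least 2 means that their sum is \<open>3 n\<close>.
  \<^item> Since squares of nonzero scalars are 1, \<open>x \<bullet> x\<close> is the weight of \<open>x\<close> modulo 3. By polarisation
    the whole Gram matrix of \<open>u, v\<close> is a function of the weights, and modulo 3 its determinant is the
    second elementary symmetric function of the four weights; the code is LCD iff this is nonzero
    (\<open>LCD_span2_iff\<close>).
  \<^item> Up to sign a nonzero column \<open>(u $ i, v $ i)\<close> is one of the four points of the projective line,
    and the number of zeros of each of the four words counts the columns at one point. Hence codes
    without zero columns and with bases of the same weights are monomially equivalent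
    (\<open>equiv_of_weights\<close>). Changes of basis permute the four weights arbitrarily
    (\<open>has_weights_change_basis\<close>), so the sorted weights form a complete invariant.

  Writing the sorted weights as \<open>d + a \<ge> d + b \<ge> d + c \<ge> d\<close>, the shift by \<open>d\<close> does not affect the
  second symmetric function modulo 3, because its cross terms are multiples of 3. The classes of LCD
  codes with minimum weight \<open>d\<close> and dual distance at least 2 thus correspond to the partitions
  \<open>a \<ge> b \<ge> c\<close> of \<open>3 n - 4 d\<close> with \<open>a + d \<le> n\<close> and \<open>a b + a c + b c\<close> not divisible by 3
  (\<open>num_inequivalent_full_LCD_codes\<close>). If \<open>a + b + c \<le> 1\<close>, then \<open>a b + a c + b c = 0\<close>; this is what
  keeps \<open>d3 n 2\<close> below the averaging bound \<open>3 n / 4\<close> for \<open>n\<close> congruent to 0 or 3 modulo 4. What remains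
  are the partitions of 4, 3, 2 and 5, of which 2, 1, 1 and 3 qualify.
\<close>

section \<open>The field of order 3\<close>

text \<open>The arithmetic below is stated with \<open>0\<close>, \<open>1\<close> and \<open>-1\<close>. By default the simplifier replaces these
  by the constructors of the type, after which the simplification rules for fields no longer match.\<close>

declare zero_finite_3_def [simp del] one_finite_3_def [simp del] two_finite_3 [simp del]

lemma F3_cases:
  fixes x :: F3
  obtains "x = 0" | "x = 1" | "x = -1"
  by (cases x) (auto simp: zero_finite_3_def one_finite_3_def uminus_finite_3_def)

lemma F3_simps [simp]: "(2::F3) = -1" "(-1::F3) \<noteq> 0" "(-1::F3) \<noteq> 1" "(1::F3) \<noteq> -1"
  by (simp_all add: zero_finite_3_def one_finite_3_def two_finite_3 uminus_finite_3_def)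

lemma F3_three [simp]: "(3::F3) = 0"
proof -
  have "(3::F3) = 1 + 1 + 1" by (simp only: numeral.simps)
  also have "\<dots> = 0" unfolding one_finite_3_def zero_finite_3_def plus_finite_3_def by simp
  finally show ?thesis .
qed

text \<open>If \<open>x\<close> and \<open>y\<close> are not both zero, then \<open>(x, y)\<close> lies on exactly one of the four lines through the
  origin, which are the zero sets of the four linear forms below. Summed over the coordinates this is the
  relation between the weights of the four words of a code of dimension 2.\<close>

lemma F3_nonzero_count:
  fixes x y :: F3
  shows "of_bool (x \<noteq> 0) + of_bool (y \<noteq> 0) + of_bool (x + y \<noteq> 0) + of_bool (x - y \<noteq> 0)
    = (3 * of_bool (x \<noteq> 0 \<or> y \<noteq> 0) :: nat)"
  by (cases x rule: F3_cases; cases y rule: F3_cases) simp_all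

lemma F3_square: "(x::F3) * x = of_bool (x \<noteq> 0)"
  by (cases x rule: F3_cases) auto

section \<open>Codes of dimension 2\<close>

definition span2 :: "F3 vec \<Rightarrow> F3 vec \<Rightarrow> F3 vec set" where
  "span2 u v = {a \<cdot>\<^sub>v u + b \<cdot>\<^sub>v v | a b. True}"

definition indep2 :: "nat \<Rightarrow> F3 vec \<Rightarrow> F3 vec \<Rightarrow> bool" where
  "indep2 n u v \<longleftrightarrow> u \<in> carrier_vec n \<and> v \<in> carrier_vec n \<and>
     (\<forall>a b. a \<cdot>\<^sub>v u + b \<cdot>\<^sub>v v = 0\<^sub>v n \<longrightarrow> a = 0 \<and> b = 0)"

lemma finite_carrier_vec: "finite (carrier_vec n :: F3 vec set)"
proof -
  have "(carrier_vec n :: F3 vec set) \<subseteq> vec_of_list ` {xs. set xs \<subseteq> UNIV \<and> length xs = n}"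
    by (auto intro!: image_eqI[of _ _ "list_of_vec _"] simp: vec_list)
  then show ?thesis
    by (rule finite_subset) (intro finite_imageI finite_lists_length_eq, simp)
qed

lemma span2_subspace:
  assumes "u \<in> carrier_vec n" "v \<in> carrier_vec n"
  shows "subspace class_ring (span2 u v) (module_vec TYPE(F3) n)"
proof -
  have add: "x + y \<in> span2 u v" if "x \<in> span2 u v" "y \<in> span2 u v" for x y
  proof -
    from that obtain a b c d where "x = a \<cdot>\<^sub>v u + b \<cdot>\<^sub>v v" "y = c \<cdot>\<^sub>v u + d \<cdot>\<^sub>v v"
      by (auto simp: span2_def)
    then have "x + y = (a + c) \<cdot>\<^sub>v u + (b + d) \<cdot>\<^sub>v v"
      using assms by (intro eq_vecI) (auto simp: algebra_simps)
    then show ?thesis by (auto simp: span2_def)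
  qed
  have zero: "0\<^sub>v n \<in> span2 u v"
  proof -
    have "0\<^sub>v n = 0 \<cdot>\<^sub>v u + 0 \<cdot>\<^sub>v v"
      using assms by (intro eq_vecI) auto
    then show ?thesis by (auto simp only: span2_def)
  qed
  have smult: "c \<cdot>\<^sub>v x \<in> span2 u v" if "x \<in> span2 u v" for c x
  proof -
    from that obtain a b where "x = a \<cdot>\<^sub>v u + b \<cdot>\<^sub>v v"
      by (auto simp: span2_def)
    then have "c \<cdot>\<^sub>v x = (c * a) \<cdot>\<^sub>v u + (c * b) \<cdot>\<^sub>v v"
      using assms by (intro eq_vecI) (auto simp: algebra_simps)
    then show ?thesis by (auto simp: span2_def)
  qed
  have "submodule class_ring (span2 u v) (module_vec TYPE(F3) n)"
    using add zero smult assms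
    by (intro submodule.intro vec_module) (auto simp: module_vec_simps span2_def class_ring_simps)
  then show ?thesis
    by (intro subspace.intro vec_vs)
qed

text \<open>The code is made into a vector space by replacing the carrier of the ambient space, so its linear
  combinations have to be computed in that restricted structure.\<close>

lemma lincomb_pair_in_code:
  assumes "subspace class_ring C (module_vec TYPE(F3) n)" "u \<in> C" "v \<in> C" "u \<noteq> v"
  shows "module.lincomb ((module_vec TYPE(F3) n)\<lparr>carrier := C\<rparr>) a {u, v} = a u \<cdot>\<^sub>v u + a v \<cdot>\<^sub>v v"
proof -
  interpret V: vectorspace class_ring "module_vec TYPE(F3) n" by (rule vec_vs)
  interpret W: vectorspace class_ring "(module_vec TYPE(F3) n)\<lparr>carrier := C\<rparr>"
    by (rule V.subspace_is_vs) fact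
  have sub: "C \<subseteq> carrier_vec n"
    using assms(1) unfolding subspace_def submodule_def by (auto simp: module_vec_simps)
  have cl: "c \<cdot>\<^sub>v x \<in> C" if "x \<in> C" for c x
    using W.smult_closed[of c x] that by (simp add: module_vec_simps class_ring_simps)
  have "a v \<cdot>\<^sub>v v \<in> carrier_vec n" using assms sub by auto
  then show ?thesis
    using assms cl unfolding W.lincomb_def
    by (subst W.finsum_insert) (auto simp: module_vec_simps)
qed

text \<open>This replaces the abstract dimension by an explicit basis, which is all that later arguments see.
  Dimension is defined through generating sets; a basis exists here because the code is finite.\<close>

lemma linear_code_2_iff:
  "linear_code n 2 C \<longleftrightarrow> (\<exists>u v. indep2 n u v \<and> C = span2 u v)"
proof (intro iffI; (elim exE conjE)?)
  assume lc: "linear_code n 2 C"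
  let ?W = "(module_vec TYPE(F3) n)\<lparr>carrier := C\<rparr>"
  have sub: "subspace class_ring C (module_vec TYPE(F3) n)"
    and dim: "vectorspace.dim class_ring ?W = 2"
    using lc by (auto simp: linear_code_def)
  interpret V: vectorspace class_ring "module_vec TYPE(F3) n" by (rule vec_vs)
  interpret W: vectorspace class_ring ?W
    by (rule V.subspace_is_vs) fact
  have C: "C \<subseteq> carrier_vec n"
    using sub unfolding subspace_def submodule_def by (auto simp: module_vec_simps)
  then have fin: "finite C" using finite_carrier_vec finite_subset by blast
  have "W.gen_set C"
    using W.span_is_subset2[of C] W.in_own_span[of C] by auto
  then have "W.fin_dim" unfolding W.fin_dim_def using fin by auto
  from W.finite_basis_exists[OF this] obtain B where B: "finite B" "W.basis B" by auto
  then have "card B = 2" using W.dim_basis dim by auto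
  then obtain u v where uv: "B = {u, v}" "u \<noteq> v" by (auto simp: card_2_iff)
  have uvC: "u \<in> C" "v \<in> C" and li: "W.lin_indpt {u, v}" and sp: "W.span {u, v} = C"
    using B uv by (auto simp: W.basis_def)
  note lcp = lincomb_pair_in_code[OF sub uvC uv(2)]
  have "C = {W.lincomb a {u,v} | a. a \<in> {u,v} \<rightarrow> carrier class_ring}"
    using W.finite_span[of "{u,v}"] uvC sp by auto
  also have "\<dots> = span2 u v"
  proof -
    have "\<exists>f. a \<cdot>\<^sub>v u + b \<cdot>\<^sub>v v = f u \<cdot>\<^sub>v u + f v \<cdot>\<^sub>v v" for a b
      using uv(2) by (intro exI[of _ "\<lambda>w. if w = u then a else b"]) auto
    then show ?thesis by (auto simp: span2_def lcp class_ring_simps)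
  qed
  finally have "C = span2 u v" .
  moreover have "indep2 n u v"
    unfolding indep2_def
  proof (intro conjI allI impI)
    fix a b assume eq: "a \<cdot>\<^sub>v u + b \<cdot>\<^sub>v v = 0\<^sub>v n"
    let ?f = "\<lambda>w. if w = u then a else b"
    have f0: "W.lincomb ?f {u,v} = \<zero>\<^bsub>?W\<^esub>"
      using eq uv(2) by (simp add: lcp module_vec_simps)
    have f_zero: "?f w = 0" if "w \<in> {u, v}" for w
    proof (rule ccontr)
      assume "?f w \<noteq> 0"
      then have "W.lin_dep {u, v}"
        using that f0 by (intro W.lin_dep_crit[of "{u,v}" "{u,v}" ?f w]) (auto simp: class_ring_simps)
      then show False using li by simp
    qed
    show "a = 0" using f_zero[of u] by simp
    show "b = 0" using f_zero[of v] uv(2) by simp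
  qed (use uvC C in auto)
  ultimately show "\<exists>u v. indep2 n u v \<and> C = span2 u v" by blast
next
  fix u v assume ind: "indep2 n u v" and C: "C = span2 u v"
  let ?W = "(module_vec TYPE(F3) n)\<lparr>carrier := C\<rparr>"
  have car: "u \<in> carrier_vec n" "v \<in> carrier_vec n" using ind by (auto simp: indep2_def)
  have sub: "subspace class_ring C (module_vec TYPE(F3) n)"
    using span2_subspace[OF car] C by simp
  interpret V: vectorspace class_ring "module_vec TYPE(F3) n" by (rule vec_vs)
  interpret W: vectorspace class_ring ?W
    by (rule V.subspace_is_vs) fact
  have "u = 1 \<cdot>\<^sub>v u + 0 \<cdot>\<^sub>v v" "v = 0 \<cdot>\<^sub>v u + 1 \<cdot>\<^sub>v v"
    using car by (auto intro!: eq_vecI)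
  then have uvC: "u \<in> C" "v \<in> C" unfolding C span2_def by blast+
  have ne: "u \<noteq> v"
  proof
    assume "u = v"
    then have "1 \<cdot>\<^sub>v u + (-1) \<cdot>\<^sub>v v = 0\<^sub>v n" using car by (auto intro!: eq_vecI)
    then have "(1::F3) = 0" using ind unfolding indep2_def by blast
    then show False by simp
  qed
  note lcp = lincomb_pair_in_code[OF sub uvC ne]
  have "\<exists>f. a \<cdot>\<^sub>v u + b \<cdot>\<^sub>v v = f u \<cdot>\<^sub>v u + f v \<cdot>\<^sub>v v" for a b
    using ne by (intro exI[of _ "\<lambda>w. if w = u then a else b"]) auto
  then have "{W.lincomb a {u, v} | a. a \<in> {u, v} \<rightarrow> carrier class_ring} = span2 u v"
    by (auto simp: span2_def lcp class_ring_simps)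
  then have "W.span {u, v} = C"
    using W.finite_span[of "{u, v}"] uvC C by simp
  moreover have "W.lin_indpt {u, v}"
    by (rule W.finite_lin_indpt2)
      (use uvC ind in \<open>auto simp: lcp indep2_def module_vec_simps class_ring_simps\<close>)
  ultimately have "W.basis {u, v}" using uvC by (simp add: W.basis_def)
  then have "W.dim = 2" using W.dim_basis[of "{u,v}"] ne by simp
  then show "linear_code n 2 C" using sub by (simp add: linear_code_def)
qed

section \<open>Weights of the words of a two-dimensional code\<close>

lemma hamming_weight_eq_sum:
  "v \<in> carrier_vec n \<Longrightarrow> hamming_weight v = (\<Sum>i<n. of_bool (v $ i \<noteq> 0))"
  by (auto simp: hamming_weight_def Int_def lessThan_def)

lemma hamming_weight_eq_0_iff:
  assumes "v \<in> carrier_vec n"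
  shows "hamming_weight v = 0 \<longleftrightarrow> v = 0\<^sub>v n"
  using assms by (auto simp: hamming_weight_def intro!: eq_vecI)

lemma hamming_weight_smult: "c \<noteq> 0 \<Longrightarrow> hamming_weight (c \<cdot>\<^sub>v v) = hamming_weight v"
  unfolding hamming_weight_def by (rule arg_cong[of _ _ card]) auto

lemma hamming_weight_le: "v \<in> carrier_vec n \<Longrightarrow> hamming_weight v \<le> n"
  unfolding hamming_weight_def
  using card_mono[of "{..<n}" "{i. i < dim_vec v \<and> v $ i \<noteq> 0}"] by auto

text \<open>Nonzero scalars square to 1, so the norm of a word counts its support modulo 3. This is the
  link between the bilinear form and weights.\<close>

lemma F3_scalar_prod_self:
  fixes v :: "F3 vec"
  shows "v \<bullet> v = of_nat (hamming_weight v)"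
proof -
  have "v \<bullet> v = (\<Sum>i<dim_vec v. of_bool (v $ i \<noteq> 0))"
    by (auto simp: scalar_prod_def F3_square atLeast0LessThan intro!: sum.cong)
  also have "\<dots> = of_nat (hamming_weight v)"
    by (simp add: hamming_weight_eq_sum[OF carrier_vec_dim_vec])
  finally show ?thesis .
qed

lemma F3_of_nat_eq_0_iff: "of_nat m = (0::F3) \<longleftrightarrow> m mod 3 = 0"
proof -
  have "(of_nat m :: F3) = of_nat (3 * (m div 3) + m mod 3)" by simp
  also have "\<dots> = of_nat (m mod 3)" by (simp only: of_nat_add of_nat_mult) simp
  finally have eq: "(of_nat m :: F3) = of_nat (m mod 3)" .
  have "m mod 3 = 0 \<or> m mod 3 = 1 \<or> m mod 3 = 2" by presburger
  then show ?thesis unfolding eq by auto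
qed

lemma hamming_weight_sum_four:
  fixes u v :: "F3 vec"
  assumes "u \<in> carrier_vec n" "v \<in> carrier_vec n"
  shows "hamming_weight u + hamming_weight v + hamming_weight (u + v) + hamming_weight (u - v)
    = 3 * card {i. i < n \<and> (u $ i \<noteq> 0 \<or> v $ i \<noteq> 0)}"
proof -
  have "hamming_weight u + hamming_weight v + hamming_weight (u + v) + hamming_weight (u - v)
      = (\<Sum>i<n. of_bool (u $ i \<noteq> 0) + of_bool (v $ i \<noteq> 0)
          + of_bool (u $ i + v $ i \<noteq> 0) + of_bool (u $ i - v $ i \<noteq> 0))"
    using assms
    by (simp add: hamming_weight_eq_sum[of _ n] sum.distrib del: sum_of_bool_eq)
  also have "\<dots> = (\<Sum>i<n. 3 * of_bool (u $ i \<noteq> 0 \<or> v $ i \<noteq> 0))"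
    by (simp only: F3_nonzero_count)
  also have "\<dots> = 3 * card {i. i < n \<and> (u $ i \<noteq> 0 \<or> v $ i \<noteq> 0)}"
    by (simp add: sum_distrib_left[symmetric] Int_def)
  finally show ?thesis .
qed

text \<open>Over a field with the two nonzero scalars \<open>1\<close> and \<open>-1\<close>, every line of the coefficient
  plane is spanned by the coefficients of one of the four listed words.\<close>

lemma combination_eq_scaled_word:
  fixes u v :: "F3 vec"
  assumes "u \<in> carrier_vec n" "v \<in> carrier_vec n" "(a, b) \<noteq> (0, 0)"
  shows "\<exists>c w. c \<noteq> 0 \<and> w \<in> {u, v, u + v, u - v} \<and> a \<cdot>\<^sub>v u + b \<cdot>\<^sub>v v = c \<cdot>\<^sub>v w"
proof -
  have "a \<cdot>\<^sub>v u + b \<cdot>\<^sub>v v = (if a = 0 then b \<cdot>\<^sub>v v else if b = 0 then a \<cdot>\<^sub>v u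
      else if a = b then a \<cdot>\<^sub>v (u + v) else a \<cdot>\<^sub>v (u - v))"
    using assms by (cases a rule: F3_cases; cases b rule: F3_cases) (auto intro!: eq_vecI)
  then show ?thesis using assms(3) by (auto split: if_splits)
qed

lemma four_words_in_span2:
  fixes u v :: "F3 vec"
  assumes "u \<in> carrier_vec n" "v \<in> carrier_vec n" 
  shows "{u, v, u + v, u - v} \<subseteq> span2 u v"
proof -
  have "u = 1 \<cdot>\<^sub>v u + 0 \<cdot>\<^sub>v v" "v = 0 \<cdot>\<^sub>v u + 1 \<cdot>\<^sub>v v" "u + v = 1 \<cdot>\<^sub>v u + 1 \<cdot>\<^sub>v v" "u - v = 1 \<cdot>\<^sub>v u + (-1) \<cdot>\<^sub>v v"
    using assms by (auto intro!: eq_vecI)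
  then show ?thesis unfolding span2_def by blast
qed

lemma indep2_iff:
  assumes "u \<in> carrier_vec n" "v \<in> carrier_vec n"
  shows "indep2 n u v \<longleftrightarrow> hamming_weight u > 0 \<and> hamming_weight v > 0 \<and>
    hamming_weight (u + v) > 0 \<and> hamming_weight (u - v) > 0"
proof -
  have "indep2 n u v \<longleftrightarrow> 0\<^sub>v n \<notin> {u, v, u + v, u - v}"
  proof
    assume i: "indep2 n u v"
    have "1 \<cdot>\<^sub>v u + 0 \<cdot>\<^sub>v v \<noteq> 0\<^sub>v n" "0 \<cdot>\<^sub>v u + 1 \<cdot>\<^sub>v v \<noteq> 0\<^sub>v n"
      "1 \<cdot>\<^sub>v u + 1 \<cdot>\<^sub>v v \<noteq> 0\<^sub>v n" "1 \<cdot>\<^sub>v u + (-1) \<cdot>\<^sub>v v \<noteq> 0\<^sub>v n"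
      using i unfolding indep2_def by (metis zero_neq_one)+
    moreover have "u = 1 \<cdot>\<^sub>v u + 0 \<cdot>\<^sub>v v" "v = 0 \<cdot>\<^sub>v u + 1 \<cdot>\<^sub>v v"
      "u + v = 1 \<cdot>\<^sub>v u + 1 \<cdot>\<^sub>v v" "u - v = 1 \<cdot>\<^sub>v u + (-1) \<cdot>\<^sub>v v"
      using assms by (auto intro!: eq_vecI)
    ultimately show "0\<^sub>v n \<notin> {u, v, u + v, u - v}" by (metis empty_iff insert_iff)
  next
    assume nz: "0\<^sub>v n \<notin> {u, v, u + v, u - v}"
    have "a = 0 \<and> b = 0" if "a \<cdot>\<^sub>v u + b \<cdot>\<^sub>v v = 0\<^sub>v n" for a b
    proof (rule ccontr)
      assume "\<not> (a = 0 \<and> b = 0)"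
      then have "(a, b) \<noteq> (0, 0)" by simp
      from combination_eq_scaled_word[OF assms this] obtain c w where "c \<noteq> 0" "w \<in> {u, v, u + v, u - v}"
        "a \<cdot>\<^sub>v u + b \<cdot>\<^sub>v v = c \<cdot>\<^sub>v w" by blast
      then have cw: "c \<noteq> 0" "w \<in> {u, v, u + v, u - v}" "c \<cdot>\<^sub>v w = 0\<^sub>v n"
        using that by simp_all
      have w: "w \<in> carrier_vec n" using cw assms by auto
      have "hamming_weight w = hamming_weight (0\<^sub>v n)"
        using cw hamming_weight_smult by metis
      then have "hamming_weight w = 0" using hamming_weight_eq_0_iff[of "0\<^sub>v n" n] by simp
      then have "w = 0\<^sub>v n" using hamming_weight_eq_0_iff[OF w] by simp
      then show False using nz cw by blast
    qed
    then show "indep2 n u v" using assms by (auto simp: indep2_def)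
  qed
  moreover have "w = 0\<^sub>v n \<longleftrightarrow> hamming_weight w = 0" if "w \<in> {u, v, u + v, u - v}" for w
    using that assms hamming_weight_eq_0_iff[of w n] by auto
  ultimately show ?thesis by (metis insert_iff empty_iff neq0_conv)
qed

lemma weights_span2:
  assumes "indep2 n u v"
  shows "hamming_weight ` (span2 u v - {0\<^sub>v n}) =
    {hamming_weight u, hamming_weight v, hamming_weight (u + v), hamming_weight (u - v)}"
proof -
  have car: "u \<in> carrier_vec n" "v \<in> carrier_vec n" using assms by (auto simp: indep2_def)
  have "hamming_weight x \<in> hamming_weight ` {u, v, u + v, u - v}"
    if "x \<in> span2 u v - {0\<^sub>v n}" for x
  proof -
    from that obtain a b where x: "x = a \<cdot>\<^sub>v u + b \<cdot>\<^sub>v v" by (auto simp: span2_def)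
    have "(a, b) \<noteq> (0, 0)" using that x car by auto
    then show ?thesis using combination_eq_scaled_word[OF car] x hamming_weight_smult by (metis imageI)
  qed
  moreover have "0\<^sub>v n \<notin> {u, v, u + v, u - v}"
    using assms car hamming_weight_eq_0_iff[of "0\<^sub>v n" n] by (auto simp: indep2_iff)
  then have "{u, v, u + v, u - v} \<subseteq> span2 u v - {0\<^sub>v n}" using four_words_in_span2[OF car] by blast
  ultimately show ?thesis by blast
qed

lemma min_weight_span2:
  assumes "indep2 n u v"
  shows "min_weight n (span2 u v) =
    Min {hamming_weight u, hamming_weight v, hamming_weight (u + v), hamming_weight (u - v)}"
  unfolding min_weight_def weights_span2[OF assms] ..

section \<open>The LCD property and the dual distance\<close>

lemma dual_code_span2:
  fixes u v :: "F3 vec"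
  assumes "u \<in> carrier_vec n" "v \<in> carrier_vec n"
  shows "dual_code n (span2 u v) = {x \<in> carrier_vec n. x \<bullet> u = 0 \<and> x \<bullet> v = 0}"
proof -
  have "x \<bullet> (a \<cdot>\<^sub>v u + b \<cdot>\<^sub>v v) = a * (x \<bullet> u) + b * (x \<bullet> v)" if "x \<in> carrier_vec n" for x a b
    using that assms by (simp add: scalar_prod_add_distrib[of _ n])
  then have "\<forall>y\<in>span2 u v. x \<bullet> y = 0" if "x \<in> carrier_vec n" "x \<bullet> u = 0" "x \<bullet> v = 0" for x
    using that by (auto simp: span2_def)
  moreover have "u \<in> span2 u v" "v \<in> span2 u v" using four_words_in_span2[OF assms] by auto
  ultimately show ?thesis unfolding dual_code_def by blast
qed

text \<open>A word of the code lies in the dual iff its coefficient vector is in the kernel of the Gram matrix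
  of the basis.\<close>

lemma LCD_span2_iff_gram:
  fixes u v :: "F3 vec"
  assumes "indep2 n u v"
  shows "LCD n (span2 u v) \<longleftrightarrow> (u \<bullet> u) * (v \<bullet> v) \<noteq> (u \<bullet> v) * (u \<bullet> v)"
proof -
  have car: "u \<in> carrier_vec n" "v \<in> carrier_vec n" using assms by (auto simp: indep2_def)
  note dual = dual_code_span2[OF car]
  have zero: "0\<^sub>v n = 0 \<cdot>\<^sub>v u + 0 \<cdot>\<^sub>v v" using car by (auto intro!: eq_vecI)
  have inner: "(a \<cdot>\<^sub>v u + b \<cdot>\<^sub>v v) \<bullet> u = a * (u \<bullet> u) + b * (u \<bullet> v)"
    "(a \<cdot>\<^sub>v u + b \<cdot>\<^sub>v v) \<bullet> v = a * (u \<bullet> v) + b * (v \<bullet> v)" for a b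
    using car comm_scalar_prod[OF car]
    by (simp_all add: add_scalar_prod_distrib[of _ n])
  have "LCD n (span2 u v) \<longleftrightarrow> (\<forall>a b. a * (u \<bullet> u) + b * (u \<bullet> v) = 0 \<and> a * (u \<bullet> v) + b * (v \<bullet> v) = 0
      \<longrightarrow> a \<cdot>\<^sub>v u + b \<cdot>\<^sub>v v = 0\<^sub>v n)"
  proof -
    have mem: "a \<cdot>\<^sub>v u + b \<cdot>\<^sub>v v \<in> dual_code n (span2 u v) \<longleftrightarrow>
        a * (u \<bullet> u) + b * (u \<bullet> v) = 0 \<and> a * (u \<bullet> v) + b * (v \<bullet> v) = 0" for a b
      unfolding dual using car by (simp add: inner)
    have "0\<^sub>v n \<in> span2 u v" using zero unfolding span2_def by blast
    moreover have "0\<^sub>v n \<in> dual_code n (span2 u v)" unfolding dual using car by simp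
    ultimately have "LCD n (span2 u v) \<longleftrightarrow>
        (\<forall>x\<in>span2 u v. x \<in> dual_code n (span2 u v) \<longrightarrow> x = 0\<^sub>v n)"
      unfolding LCD_def by blast
    also have "\<dots> \<longleftrightarrow> (\<forall>a b. a \<cdot>\<^sub>v u + b \<cdot>\<^sub>v v \<in> dual_code n (span2 u v) \<longrightarrow>
        a \<cdot>\<^sub>v u + b \<cdot>\<^sub>v v = 0\<^sub>v n)"
      unfolding span2_def by blast
    finally show ?thesis unfolding mem .
  qed
  also have "\<dots> \<longleftrightarrow> (\<forall>a b. a * (u \<bullet> u) + b * (u \<bullet> v) = 0 \<and> a * (u \<bullet> v) + b * (v \<bullet> v) = 0
      \<longrightarrow> a = 0 \<and> b = 0)"
    proof -
    have "a \<cdot>\<^sub>v u + b \<cdot>\<^sub>v v = 0\<^sub>v n \<longleftrightarrow> a = 0 \<and> b = 0" for a b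
      using assms zero unfolding indep2_def by metis
    then show ?thesis by simp
  qed
  also have "\<dots> \<longleftrightarrow> (u \<bullet> u) * (v \<bullet> v) \<noteq> (u \<bullet> v) * (u \<bullet> v)" (is "?L \<longleftrightarrow> ?R")
  proof
    assume L: ?L
    show ?R
    proof
      assume eq: "(u \<bullet> u) * (v \<bullet> v) = (u \<bullet> v) * (u \<bullet> v)"
      \<comment> \<open>A singular Gram matrix is annihilated by the row \<open>(v \<bullet> v, - (u \<bullet> v))\<close> of its adjugate.\<close>
      have "v \<bullet> v = 0" "u \<bullet> v = 0"
        using L[rule_format, of "v \<bullet> v" "- (u \<bullet> v)"] eq by (auto simp: algebra_simps)
      then show False using L[rule_format, of 0 1] by auto
    qed
  next
    assume R: ?R
    show ?L
    proof (intro allI impI)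
      fix a b assume "a * (u \<bullet> u) + b * (u \<bullet> v) = 0 \<and> a * (u \<bullet> v) + b * (v \<bullet> v) = 0"
      then have ab: "a * (u \<bullet> u) + b * (u \<bullet> v) = 0" "a * (u \<bullet> v) + b * (v \<bullet> v) = 0" by auto
      let ?D = "(u \<bullet> u) * (v \<bullet> v) - (u \<bullet> v) * (u \<bullet> v)"
      have "a * ?D =
          (a * (u \<bullet> u) + b * (u \<bullet> v)) * (v \<bullet> v) - (a * (u \<bullet> v) + b * (v \<bullet> v)) * (u \<bullet> v)"
        by (simp add: algebra_simps)
      then have "a * ?D = 0" unfolding ab by simp
      moreover have "b * ?D =
          (a * (u \<bullet> v) + b * (v \<bullet> v)) * (u \<bullet> u) - (a * (u \<bullet> u) + b * (u \<bullet> v)) * (u \<bullet> v)"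
        by (simp add: algebra_simps)
      then have "b * ?D = 0" unfolding ab by simp
      ultimately show "a = 0 \<and> b = 0" using R by simp
    qed
  qed
  finally show ?thesis .
qed

text \<open>The second elementary symmetric function.\<close>

definition pair_sum :: "nat \<Rightarrow> nat \<Rightarrow> nat \<Rightarrow> nat \<Rightarrow> nat" where
  "pair_sum p q r s = p * q + p * r + p * s + q * r + q * s + r * s"

text \<open>With \<open>p = u \<bullet> u\<close>, \<open>q = v \<bullet> v\<close> and \<open>g = u \<bullet> v\<close>, the norms of \<open>u + v\<close> and \<open>u - v\<close> are \<open>r\<close> and \<open>s\<close>;
  then the second symmetric function of the four norms is the Gram determinant, because \<open>3 = 0\<close>.\<close>

lemma F3_gram_det:
  fixes p q g :: F3
  defines "r \<equiv> p + 2 * g + q" and "s \<equiv> p - 2 * g + q"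
  shows "p * q + p * r + p * s + q * r + q * s + r * s = p * q - g * g"
  unfolding r_def s_def
  by (cases p rule: F3_cases; cases q rule: F3_cases; cases g rule: F3_cases) simp_all

text \<open>The criterion is symmetric in the four weights, hence does not depend on the basis that was used to
  compute them.\<close>

lemma LCD_span2_iff:
  assumes "indep2 n u v"
  shows "LCD n (span2 u v) \<longleftrightarrow>
    pair_sum (hamming_weight u) (hamming_weight v) (hamming_weight (u + v)) (hamming_weight (u - v)) mod 3 \<noteq> 0"
proof -
  have car: "u \<in> carrier_vec n" "v \<in> carrier_vec n" using assms by (auto simp: indep2_def)
  define p q r s :: F3 where "p = of_nat (hamming_weight u)" and "q = of_nat (hamming_weight v)"
    and "r = of_nat (hamming_weight (u + v))" and "s = of_nat (hamming_weight (u - v))"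
  have r: "r = p + 2 * (u \<bullet> v) + q" and s: "s = p - 2 * (u \<bullet> v) + q"
    unfolding p_def q_def r_def s_def F3_scalar_prod_self[symmetric]
    using car comm_scalar_prod[OF car]
    by (simp_all only: add_scalar_prod_distrib[of _ n] scalar_prod_add_distrib[of _ n] mult_2
        minus_scalar_prod_distrib[of _ n] scalar_prod_minus_distrib[of _ n] add_carrier_vec minus_carrier_vec)
      (simp_all add: algebra_simps)
  have "of_nat (pair_sum (hamming_weight u) (hamming_weight v) (hamming_weight (u + v)) (hamming_weight (u - v)))
      = p * q + p * r + p * s + q * r + q * s + r * s"
    by (simp add: pair_sum_def p_def q_def r_def s_def)
  also have "\<dots> = (u \<bullet> u) * (v \<bullet> v) - (u \<bullet> v) * (u \<bullet> v)"
    unfolding r s F3_gram_det unfolding p_def q_def F3_scalar_prod_self ..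
  finally show ?thesis
    unfolding LCD_span2_iff_gram[OF assms] F3_of_nat_eq_0_iff[symmetric] by simp
qed

text \<open>A dual word of weight 1 supported at \<open>i\<close> exists iff every codeword vanishes at \<open>i\<close>. The minimum
  weight of the dual is only meaningful if the dual has a nonzero word, and \<open>n \<ge> 3\<close> guarantees this.\<close>

lemma dual_distance_span2_ge_2_iff:
  fixes u v :: "F3 vec"
  assumes n: "n \<ge> 3" and car: "u \<in> carrier_vec n" "v \<in> carrier_vec n"
  shows "dual_distance n (span2 u v) \<ge> 2 \<longleftrightarrow> (\<forall>i<n. u $ i \<noteq> 0 \<or> v $ i \<noteq> 0)"
proof -
  define X where "X = dual_code n (span2 u v) - {0\<^sub>v n}"
  have X: "x \<in> X \<longleftrightarrow> x \<in> carrier_vec n \<and> x \<bullet> u = 0 \<and> x \<bullet> v = 0 \<and> x \<noteq> 0\<^sub>v n" for x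
    by (auto simp: X_def dual_code_span2[OF car])
  have fin: "finite X"
    by (rule finite_subset[OF _ finite_carrier_vec[of n]]) (auto simp: X)
  have "X \<noteq> {}"
  proof -
    \<comment> \<open>Two scalar products take at most 9 pairs of values on the 27 words supported on the first three
      coordinates, so two of these words differ by a dual word.\<close>
    define w :: "F3 \<times> F3 \<times> F3 \<Rightarrow> F3 vec" where
      "w = (\<lambda>(a, b, c). a \<cdot>\<^sub>v unit_vec n 0 + b \<cdot>\<^sub>v unit_vec n 1 + c \<cdot>\<^sub>v unit_vec n 2)"
    define f where "f t = (w t \<bullet> u, w t \<bullet> v)" for t
    have w_car: "w t \<in> carrier_vec n" for t by (cases t) (auto simp: w_def)
    have "card (range f) \<le> card (UNIV :: (F3 \<times> F3) set)" by (intro card_mono) auto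
    then have "card (range f) < card (UNIV :: (F3 \<times> F3 \<times> F3) set)"
      by (simp add: card_cartesian_product UNIV_finite_3 flip: UNIV_Times_UNIV)
    then have "\<not> inj f" by (rule pigeonhole)
    then obtain s t where st: "f s = f t" "s \<noteq> t" by (auto simp: inj_def)
    have "w s \<noteq> w t"
    proof
      assume "w s = w t"
      then have "w s $ i = w t $ i" for i by simp
      from this[of 0] this[of 1] this[of 2] show False
        using n st(2) by (cases s; cases t) (auto simp: w_def)
    qed
    moreover have "w s = w t" if "w s - w t = 0\<^sub>v n"
    proof (rule eq_vecI)
      fix i assume "i < dim_vec (w t)"
      then show "w s $ i = w t $ i"
        using arg_cong[OF that, of "\<lambda>x. x $ i"] w_car[of s] w_car[of t] by auto
    qed (use w_car[of s] w_car[of t] in auto)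
    ultimately have "w s - w t \<in> X"
      using w_car[of s] w_car[of t] car st
      by (auto simp: X f_def minus_scalar_prod_distrib[of _ n])
    then show ?thesis by blast
  qed
  then have "dual_distance n (span2 u v) \<ge> 2 \<longleftrightarrow> (\<forall>x\<in>X. hamming_weight x \<ge> 2)"
    using fin by (simp add: dual_distance_def min_weight_def flip: X_def)
  also have "\<dots> \<longleftrightarrow> (\<forall>i<n. u $ i \<noteq> 0 \<or> v $ i \<noteq> 0)"
  proof safe
    fix i assume H: "\<forall>x\<in>X. hamming_weight x \<ge> 2" and i: "i < n" "v $ i = 0" "u $ i = 0"
    have "unit_vec n i \<in> X" using i car by (auto simp: X)
    moreover have "hamming_weight (unit_vec n i) = 1"
    proof -
      have "{j. j < dim_vec (unit_vec n i :: F3 vec) \<and> (unit_vec n i :: F3 vec) $ j \<noteq> 0} = {i}"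
        using i by (auto split: if_splits)
      then show ?thesis by (simp add: hamming_weight_def)
    qed
    ultimately show False using H by force
  next
    fix x assume H: "\<forall>i<n. u $ i \<noteq> 0 \<or> v $ i \<noteq> 0" and x: "x \<in> X"
    have xc: "x \<in> carrier_vec n" "dim_vec x = n" "x \<bullet> u = 0" "x \<bullet> v = 0" using x by (auto simp: X)
    have "hamming_weight x \<noteq> 0" using x hamming_weight_eq_0_iff by (auto simp: X)
    moreover have "hamming_weight x \<noteq> 1"
    proof
      assume "hamming_weight x = 1"
      then obtain i where i: "{i. i < n \<and> x $ i \<noteq> 0} = {i}"
        using xc by (auto simp: hamming_weight_def card_1_singleton_iff)
      then have "i < n" "x $ i \<noteq> 0" and other: "\<And>j. j < n \<Longrightarrow> j \<noteq> i \<Longrightarrow> x $ j = 0" by auto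
      have "x \<bullet> w = x $ i * w $ i" if "w \<in> carrier_vec n" for w
      proof -
        have "x \<bullet> w = (\<Sum>j\<in>{0..<n}. x $ j * w $ j)" using that by (simp add: scalar_prod_def)
        also have "\<dots> = (\<Sum>j\<in>{i}. x $ j * w $ j)"
          by (rule sum.mono_neutral_right) (use \<open>i < n\<close> other in auto)
        finally show ?thesis by simp
      qed
      then have "x $ i * u $ i = 0" "x $ i * v $ i = 0" using xc car by metis+
      then show False using H \<open>i < n\<close> \<open>x $ i \<noteq> 0\<close> by auto
    qed
    ultimately show "hamming_weight x \<ge> 2" by linarith
  qed
  finally show ?thesis .
qed

section \<open>Monomial equivalence\<close>

text \<open>The action of a monomial matrix on words: in column \<open>j\<close> its nonzero entry \<open>e j\<close> is in row \<open>\<pi> j\<close>.\<close>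

definition signed_perm :: "nat \<Rightarrow> (nat \<Rightarrow> nat) \<Rightarrow> (nat \<Rightarrow> F3) \<Rightarrow> F3 vec \<Rightarrow> F3 vec" where
  "signed_perm n \<pi> e c = vec n (\<lambda>j. e j * c $ \<pi> j)"

lemma transpose_mult_monomial:
  assumes P: "P \<in> carrier_mat n n" and c: "c \<in> carrier_vec n"
    and \<pi>: "\<And>j. j < n \<Longrightarrow> \<pi> j < n"
    and z: "\<And>i j. i < n \<Longrightarrow> j < n \<Longrightarrow> i \<noteq> \<pi> j \<Longrightarrow> P $$ (i, j) = 0"
  shows "transpose_mat P *\<^sub>v c = signed_perm n \<pi> (\<lambda>j. P $$ (\<pi> j, j)) c"
proof (rule eq_vecI)
  fix j assume "j < dim_vec (signed_perm n \<pi> (\<lambda>j. P $$ (\<pi> j, j)) c)"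
  then have j: "j < n" by (simp add: signed_perm_def)
  have "(transpose_mat P *\<^sub>v c) $ j = (\<Sum>i\<in>{0..<n}. P $$ (i, j) * c $ i)"
    using P c j by (simp add: scalar_prod_def)
  also have "\<dots> = (\<Sum>i\<in>{\<pi> j}. P $$ (i, j) * c $ i)"
    by (rule sum.mono_neutral_right) (use j \<pi> z in auto)
  finally show "(transpose_mat P *\<^sub>v c) $ j = signed_perm n \<pi> (\<lambda>j. P $$ (\<pi> j, j)) c $ j"
    using j by (simp add: signed_perm_def)
qed (use P in \<open>simp add: signed_perm_def\<close>)

text \<open>Reading a monomial matrix as a permutation with signs makes its effect on weights and its
  construction from matching columns transparent.\<close>

lemma code_equiv_iff:
  "(C, D) \<in> code_equiv n \<longleftrightarrow> C \<subseteq> carrier_vec n \<and>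
    (\<exists>\<pi> e. \<pi> permutes {..<n} \<and> (\<forall>j<n. e j \<noteq> 0) \<and> D = signed_perm n \<pi> e ` C)"
proof
  assume "(C, D) \<in> code_equiv n"
  then obtain P where C: "C \<subseteq> carrier_vec n" and P: "monomial_mat n P"
    and D: "D = {transpose_mat P *\<^sub>v c | c. c \<in> C}"
    by (auto simp: code_equiv_def)
  define \<pi> where "\<pi> j = (if j < n then THE i. i < n \<and> P $$ (i, j) \<noteq> 0 else j)" for j
  have Pc: "P \<in> carrier_mat n n" using P by (simp add: monomial_mat_def)
  have row: "\<exists>!j. j < n \<and> P $$ (i, j) \<noteq> 0" if "i < n" for i
    using P that by (simp add: monomial_mat_def)
  have col: "\<exists>!i. i < n \<and> P $$ (i, j) \<noteq> 0" if "j < n" for j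
    using P that by (simp add: monomial_mat_def)
  have \<pi>: "\<pi> j < n \<and> P $$ (\<pi> j, j) \<noteq> 0" if "j < n" for j
    using theI'[OF col[OF that]] that by (simp add: \<pi>_def)
  have uniq: "i = \<pi> j" if "i < n" "j < n" "P $$ (i, j) \<noteq> 0" for i j
    using col[OF that(2)] that \<pi>[OF that(2)] by (elim ex1E) metis
  have "inj_on \<pi> {..<n}"
  proof (rule inj_onI)
    fix j k assume "j \<in> {..<n}" "k \<in> {..<n}" "\<pi> j = \<pi> k"
    then have "j < n" "k < n" "\<pi> j < n" "P $$ (\<pi> j, j) \<noteq> 0" "P $$ (\<pi> j, k) \<noteq> 0"
      using \<pi>[of j] \<pi>[of k] by auto
    then show "j = k" using row[of "\<pi> j"] by blast
  qed
  moreover have "\<pi> ` {..<n} \<subseteq> {..<n}" using \<pi> by auto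
  ultimately have "bij_betw \<pi> {..<n} {..<n}"
    using endo_inj_surj[of "{..<n}" \<pi>] by (auto simp: bij_betw_def)
  then have "\<pi> permutes {..<n}" by (rule bij_imp_permutes) (simp add: \<pi>_def)
  moreover have "transpose_mat P *\<^sub>v c = signed_perm n \<pi> (\<lambda>j. P $$ (\<pi> j, j)) c" if "c \<in> C" for c
    by (rule transpose_mult_monomial) (use that C Pc \<pi> uniq in auto)
  then have "D = signed_perm n \<pi> (\<lambda>j. P $$ (\<pi> j, j)) ` C"
    unfolding D Setcompr_eq_image by (intro image_cong refl)
  ultimately show "C \<subseteq> carrier_vec n \<and>
      (\<exists>\<pi> e. \<pi> permutes {..<n} \<and> (\<forall>j<n. e j \<noteq> 0) \<and> D = signed_perm n \<pi> e ` C)"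
    using C \<pi> by (intro conjI exI[of _ \<pi>] exI[of _ "\<lambda>j. P $$ (\<pi> j, j)"]) auto
next
  assume "C \<subseteq> carrier_vec n \<and>
      (\<exists>\<pi> e. \<pi> permutes {..<n} \<and> (\<forall>j<n. e j \<noteq> 0) \<and> D = signed_perm n \<pi> e ` C)"
  then obtain \<pi> e where C: "C \<subseteq> carrier_vec n" and \<pi>: "\<pi> permutes {..<n}"
    and e: "\<And>j. j < n \<Longrightarrow> e j \<noteq> 0" and D: "D = signed_perm n \<pi> e ` C" by auto
  define P where "P = mat n n (\<lambda>(i, j). if i = \<pi> j then e j else 0)"
  have \<pi>_less: "\<pi> j < n \<longleftrightarrow> j < n" for j using permutes_in_image[OF \<pi>, of j] by simp
  have "monomial_mat n P"
  proof -
    have "\<exists>!j. j < n \<and> P $$ (i, j) \<noteq> 0" if i: "i < n" for i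
    proof (rule ex1I)
      show "inv_into UNIV \<pi> i < n \<and> P $$ (i, inv_into UNIV \<pi> i) \<noteq> 0"
        using i e \<pi>_less[of "inv_into UNIV \<pi> i"] permutes_inverses[OF \<pi>] by (auto simp: P_def)
      show "j = inv_into UNIV \<pi> i" if "j < n \<and> P $$ (i, j) \<noteq> 0" for j
        using that i permutes_inverses[OF \<pi>] by (auto simp: P_def split: if_splits)
    qed
    moreover have "\<exists>!i. i < n \<and> P $$ (i, j) \<noteq> 0" if "j < n" for j
      using that e \<pi>_less[of j] by (intro ex1I[of _ "\<pi> j"]) (auto simp: P_def split: if_splits)
    ultimately show ?thesis by (simp add: monomial_mat_def P_def)
  qed
  moreover have "transpose_mat P *\<^sub>v c = signed_perm n \<pi> e c" if "c \<in> C" for c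
  proof -
    have "transpose_mat P *\<^sub>v c = signed_perm n \<pi> (\<lambda>j. P $$ (\<pi> j, j)) c"
      by (rule transpose_mult_monomial) (use that C \<pi>_less in \<open>auto simp: P_def\<close>)
    also have "\<dots> = signed_perm n \<pi> e c"
      by (rule eq_vecI) (simp_all add: signed_perm_def P_def \<pi>_less)
    finally show ?thesis .
  qed
  then have "D = {transpose_mat P *\<^sub>v c | c. c \<in> C}"
    unfolding D Setcompr_eq_image by (intro image_cong refl) simp
  ultimately show "(C, D) \<in> code_equiv n" using C unfolding code_equiv_def by blast
qed

lemma signed_perm_carrier [simp]: "signed_perm n \<pi> e c \<in> carrier_vec n"
  by (simp add: signed_perm_def)

lemma hamming_weight_signed_perm:
  assumes \<pi>: "\<pi> permutes {..<n}" and e: "\<forall>j<n. e j \<noteq> 0" and c: "c \<in> carrier_vec n"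
  shows "hamming_weight (signed_perm n \<pi> e c) = hamming_weight c"
proof -
  have "hamming_weight (signed_perm n \<pi> e c) = (\<Sum>j<n. of_bool (signed_perm n \<pi> e c $ j \<noteq> 0))"
    by (rule hamming_weight_eq_sum) simp
  also have "\<dots> = (\<Sum>j<n. of_bool (c $ \<pi> j \<noteq> 0))"
    by (rule sum.cong) (use e in \<open>auto simp: signed_perm_def\<close>)
  also have "\<dots> = (\<Sum>j<n. of_bool (c $ j \<noteq> 0))"
    using sum.permute[OF \<pi>, of "\<lambda>j. of_bool (c $ j \<noteq> 0)"] unfolding comp_def by (rule sym)
  finally show ?thesis using hamming_weight_eq_sum[OF c] by simp
qed

lemma signed_perm_comb:
  assumes \<pi>: "\<pi> permutes {..<n}" and "u \<in> carrier_vec n" "v \<in> carrier_vec n"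
  shows "signed_perm n \<pi> e (a \<cdot>\<^sub>v u + b \<cdot>\<^sub>v v) = a \<cdot>\<^sub>v signed_perm n \<pi> e u + b \<cdot>\<^sub>v signed_perm n \<pi> e v"
proof (rule eq_vecI)
  fix j assume "j < dim_vec (a \<cdot>\<^sub>v signed_perm n \<pi> e u + b \<cdot>\<^sub>v signed_perm n \<pi> e v)"
  then have "j < n" by (simp add: signed_perm_def)
  moreover from this have "\<pi> j < n" using permutes_in_image[OF \<pi>, of j] by simp
  ultimately show "signed_perm n \<pi> e (a \<cdot>\<^sub>v u + b \<cdot>\<^sub>v v) $ j =
      (a \<cdot>\<^sub>v signed_perm n \<pi> e u + b \<cdot>\<^sub>v signed_perm n \<pi> e v) $ j"
    using assms by (simp add: signed_perm_def algebra_simps)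
qed (simp add: signed_perm_def)

lemma signed_perm_span2:
  assumes "\<pi> permutes {..<n}" and "u \<in> carrier_vec n" "v \<in> carrier_vec n"
  shows "signed_perm n \<pi> e ` span2 u v = span2 (signed_perm n \<pi> e u) (signed_perm n \<pi> e v)"
proof -
  have "signed_perm n \<pi> e ` span2 u v = {signed_perm n \<pi> e (a \<cdot>\<^sub>v u + b \<cdot>\<^sub>v v) | a b. True}"
    unfolding span2_def by blast
  then show ?thesis unfolding signed_perm_comb[OF assms] span2_def .
qed

section \<open>The four weights as a complete invariant\<close>

text \<open>The weights are recorded for some basis, in the order determined by that basis; a code has them
  in every order, by \<open>has_weights_change_basis\<close>.\<close>

definition has_weights :: "nat \<Rightarrow> F3 vec set \<Rightarrow> nat \<Rightarrow> nat \<Rightarrow> nat \<Rightarrow> nat \<Rightarrow> bool" where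
  "has_weights n C p q r s \<longleftrightarrow> (\<exists>u\<in>carrier_vec n. \<exists>v\<in>carrier_vec n. C = span2 u v \<and>
     hamming_weight u = p \<and> hamming_weight v = q \<and>
     hamming_weight (u + v) = r \<and> hamming_weight (u - v) = s)"

lemma has_weights_equiv:
  assumes "has_weights n C p q r s" "(C, D) \<in> code_equiv n"
  shows "has_weights n D p q r s"
proof -
  obtain u v where uv: "u \<in> carrier_vec n" "v \<in> carrier_vec n" "C = span2 u v"
    "hamming_weight u = p" "hamming_weight v = q" "hamming_weight (u + v) = r" "hamming_weight (u - v) = s"
    using assms(1) by (auto simp: has_weights_def)
  obtain \<pi> e where \<pi>: "\<pi> permutes {..<n}" and e: "\<forall>j<n. e j \<noteq> 0" and D: "D = signed_perm n \<pi> e ` C"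
    using assms(2) by (auto simp: code_equiv_iff)
  let ?f = "signed_perm n \<pi> e"
  have comb: "u + v = 1 \<cdot>\<^sub>v u + 1 \<cdot>\<^sub>v v" "u - v = 1 \<cdot>\<^sub>v u + (-1) \<cdot>\<^sub>v v"
    "?f u + ?f v = 1 \<cdot>\<^sub>v ?f u + 1 \<cdot>\<^sub>v ?f v" "?f u - ?f v = 1 \<cdot>\<^sub>v ?f u + (-1) \<cdot>\<^sub>v ?f v"
    using uv by (auto intro!: eq_vecI simp: signed_perm_def)
  have "?f (u + v) = ?f u + ?f v" "?f (u - v) = ?f u - ?f v"
    using signed_perm_comb[OF \<pi> uv(1,2), of e] unfolding comb by blast+
  then have "hamming_weight (?f u + ?f v) = r" "hamming_weight (?f u - ?f v) = s"
    using hamming_weight_signed_perm[OF \<pi> e] uv by (metis add_carrier_vec, metis minus_carrier_vec)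
  moreover have "D = span2 (?f u) (?f v)" using D uv signed_perm_span2[OF \<pi> uv(1,2)] by simp
  moreover have "hamming_weight (?f u) = p" "hamming_weight (?f v) = q"
    using hamming_weight_signed_perm[OF \<pi> e] uv by auto
  moreover have "?f u \<in> carrier_vec n" "?f v \<in> carrier_vec n" by simp_all
  ultimately show ?thesis unfolding has_weights_def by blast
qed

text \<open>The four points of the projective line, numbered by which of the linear forms \<open>x\<close>, \<open>y\<close>, \<open>x + y\<close>,
  \<open>x - y\<close> vanishes there.\<close>

definition point_index :: "F3 \<Rightarrow> F3 \<Rightarrow> nat" where
  "point_index x y = (if x = 0 then 0 else if y = 0 then 1 else if x + y = 0 then 2 else 3)"

lemma point_index_eqD:
  assumes "point_index x y = point_index x' y'" "x \<noteq> 0 \<or> y \<noteq> 0" "x' \<noteq> 0 \<or> y' \<noteq> 0"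
  shows "\<exists>e. e \<noteq> 0 \<and> x' = e * x \<and> y' = e * y"
proof -
  have "(x' = 1 * x \<and> y' = 1 * y) \<or> (x' = -1 * x \<and> y' = -1 * y)"
    using assms unfolding point_index_def
    by (cases x rule: F3_cases; cases y rule: F3_cases; cases x' rule: F3_cases; cases y' rule: F3_cases)
      simp_all
  moreover have "(1::F3) \<noteq> 0" "(-1::F3) \<noteq> 0" by simp_all
  ultimately show ?thesis by blast
qed

lemma point_index_iff:
  assumes "x \<noteq> 0 \<or> y \<noteq> 0"
  shows "point_index x y = 0 \<longleftrightarrow> x = 0" "point_index x y = 1 \<longleftrightarrow> y = 0"
    "point_index x y = 2 \<longleftrightarrow> x + y = 0" "point_index x y = 3 \<longleftrightarrow> x - y = 0"
  using assms unfolding point_index_def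
  by (cases x rule: F3_cases; cases y rule: F3_cases; simp)+

lemma card_zeros:
  assumes "w \<in> carrier_vec n"
  shows "card {i. i < n \<and> w $ i = 0} = n - hamming_weight w"
proof -
  have "{i. i < n \<and> w $ i = 0} = {..<n} - {i. i < dim_vec w \<and> w $ i \<noteq> 0}" using assms by auto
  also have "card \<dots> = n - hamming_weight w"
    unfolding hamming_weight_def using assms by (subst card_Diff_subset) auto
  finally show ?thesis .
qed

text \<open>The sum condition says that neither code has a zero column. The columns at a given projective
  point are then counted by the zeros of one of the four words, so both codes have equally many columns at
  each point. A permutation matching columns at the same point, with signs correcting the
  choice of representatives, carries one basis to the other.\<close>

lemma equiv_of_weights:
  assumes C: "has_weights n C p q r s" and D: "has_weights n D p q r s"
    and full: "p + q + r + s = 3 * n"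
  shows "(C, D) \<in> code_equiv n"
proof -
  obtain u v where uv: "u \<in> carrier_vec n" "v \<in> carrier_vec n" "C = span2 u v"
    "hamming_weight u = p" "hamming_weight v = q" "hamming_weight (u + v) = r" "hamming_weight (u - v) = s"
    using C by (auto simp: has_weights_def)
  obtain u' v' where uv': "u' \<in> carrier_vec n" "v' \<in> carrier_vec n" "D = span2 u' v'"
    "hamming_weight u' = p" "hamming_weight v' = q" "hamming_weight (u' + v') = r" "hamming_weight (u' - v') = s"
    using D by (auto simp: has_weights_def)
  have nz: "x $ i \<noteq> 0 \<or> y $ i \<noteq> 0"
    if "i < n" and xy: "x \<in> carrier_vec n" "y \<in> carrier_vec n"
      and w: "hamming_weight x = p" "hamming_weight y = q" "hamming_weight (x + y) = r" "hamming_weight (x - y) = s"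
    for x y :: "F3 vec" and i
  proof -
    have "card {i. i < n \<and> (x $ i \<noteq> 0 \<or> y $ i \<noteq> 0)} = n"
      using hamming_weight_sum_four[OF xy] w full by simp
    then have "{i. i < n \<and> (x $ i \<noteq> 0 \<or> y $ i \<noteq> 0)} = {..<n}"
      by (intro card_subset_eq) auto
    then show ?thesis using \<open>i < n\<close> by auto
  qed
  define \<tau> where "\<tau> x y i = point_index (x $ i) (y $ i)" for x y :: "F3 vec" and i
  have count: "count (image_mset (\<tau> x y) (mset_set {..<n})) k =
      (if k = 0 then n - p else if k = 1 then n - q else if k = 2 then n - r else if k = 3 then n - s else 0)"
    if xy: "x \<in> carrier_vec n" "y \<in> carrier_vec n"
      and w: "hamming_weight x = p" "hamming_weight y = q" "hamming_weight (x + y) = r" "hamming_weight (x - y) = s"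
    for x y k
  proof -
    have "count (image_mset (\<tau> x y) (mset_set {..<n})) k = card {i. i < n \<and> \<tau> x y i = k}"
      by (simp add: count_image_mset vimage_def Int_def conj_commute)
    also have "\<dots> = (if k = 0 then n - p else if k = 1 then n - q else if k = 2 then n - r
        else if k = 3 then n - s else 0)"
    proof -
      note * = point_index_iff[OF nz[OF _ that]]
      consider "k = 0" | "k = 1" | "k = 2" | "k = 3" | "k > 3" by linarith
      then show ?thesis
      proof cases
        case 1
        have "{i. i < n \<and> \<tau> x y i = k} = {i. i < n \<and> x $ i = 0}"
          using 1 *(1) by (auto simp: \<tau>_def)
        then show ?thesis using 1 card_zeros[of x n] xy w by simp
      next
        case 2
        have "{i. i < n \<and> \<tau> x y i = k} = {i. i < n \<and> y $ i = 0}"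
          using 2 *(2) by (auto simp: \<tau>_def)
        then show ?thesis using 2 card_zeros[of y n] xy w by simp
      next
        case 3
        have "{i. i < n \<and> \<tau> x y i = k} = {i. i < n \<and> (x + y) $ i = 0}"
          using 3 *(3) xy by (auto simp: \<tau>_def)
        then show ?thesis using 3 card_zeros[of "x + y" n] xy w by simp
      next
        case 4
        have "{i. i < n \<and> \<tau> x y i = k} = {i. i < n \<and> (x - y) $ i = 0}"
          using 4 *(4) xy by (intro Collect_cong conj_cong refl) (simp add: \<tau>_def)
        then show ?thesis using 4 card_zeros[of "x - y" n] xy w by simp
      next
        case 5
        then have "{i. i < n \<and> \<tau> x y i = k} = {}" by (auto simp: \<tau>_def point_index_def)
        then have "card {i. i < n \<and> \<tau> x y i = k} = 0" by (simp only: card.empty)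
        then show ?thesis using 5 by simp
      qed
    qed
    finally show ?thesis .
  qed
  have "image_mset (\<tau> u' v') (mset_set {..<n}) = image_mset (\<tau> u v) (mset_set {..<n})"
    by (rule multiset_eqI) (simp only: count[OF uv(1,2,4-7)] count[OF uv'(1,2,4-7)])
  from image_mset_eq_implies_permutes[OF _ this] obtain \<pi>
    where \<pi>: "\<pi> permutes {..<n}" and \<tau>: "\<forall>i\<in>{..<n}. \<tau> u' v' i = \<tau> u v (\<pi> i)" by auto
  have \<pi>_less: "\<pi> i < n" if "i < n" for i using permutes_in_image[OF \<pi>, of i] that by simp
  have "\<forall>i\<in>{..<n}. \<exists>e. e \<noteq> 0 \<and> u' $ i = e * u $ \<pi> i \<and> v' $ i = e * v $ \<pi> i"
  proof
    fix i assume "i \<in> {..<n}"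
    then have "i < n" by simp
    then show "\<exists>e. e \<noteq> 0 \<and> u' $ i = e * u $ \<pi> i \<and> v' $ i = e * v $ \<pi> i"
      using \<tau> nz[OF \<pi>_less[OF \<open>i < n\<close>] uv(1,2,4-7)] nz[OF \<open>i < n\<close> uv'(1,2,4-7)]
      by (intro point_index_eqD) (auto simp: \<tau>_def)
  qed
  then obtain e where e: "\<And>i. i < n \<Longrightarrow> e i \<noteq> 0 \<and> u' $ i = e i * u $ \<pi> i \<and> v' $ i = e i * v $ \<pi> i"
    unfolding bchoice_iff by auto
  have "u' = signed_perm n \<pi> e u" "v' = signed_perm n \<pi> e v"
    using uv' e by (auto simp: signed_perm_def intro!: eq_vecI)
  then have "D = signed_perm n \<pi> e ` C"
    using signed_perm_span2[OF \<pi> uv(1,2)] uv uv' by simp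
  moreover have "C \<subseteq> carrier_vec n" using uv by (auto simp: span2_def)
  ultimately show ?thesis using \<pi> e unfolding code_equiv_iff by blast
qed

lemma span2_eqI:
  assumes "\<And>a b. \<exists>c d. a \<cdot>\<^sub>v u + b \<cdot>\<^sub>v v = c \<cdot>\<^sub>v u' + d \<cdot>\<^sub>v v'"
    and "\<And>a b. \<exists>c d. a \<cdot>\<^sub>v u' + b \<cdot>\<^sub>v v' = c \<cdot>\<^sub>v u + d \<cdot>\<^sub>v v"
  shows "span2 u v = span2 u' v'"
proof
  show "span2 u v \<subseteq> span2 u' v'" unfolding span2_def using assms(1) by blast
  show "span2 u' v' \<subseteq> span2 u v" unfolding span2_def using assms(2) by blast
qed

lemma hamming_weight_uminus: "hamming_weight (- v) = hamming_weight v"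
  unfolding hamming_weight_def by (rule arg_cong[of _ _ card]) auto

text \<open>The bases \<open>(v, u)\<close>, \<open>(u, - v)\<close> and \<open>(- u, u + v)\<close> realise the three adjacent transpositions of the
  list of weights; for the last one \<open>- u - (u + v) = u - v\<close> because \<open>-2 = 1\<close>.\<close>

lemma has_weights_change_basis:
  assumes "has_weights n C p q r s"
  shows "has_weights n C q p r s" "has_weights n C p q s r" "has_weights n C p r q s"
proof -
  obtain u v where uv: "u \<in> carrier_vec n" "v \<in> carrier_vec n" "C = span2 u v"
    "hamming_weight u = p" "hamming_weight v = q" "hamming_weight (u + v) = r" "hamming_weight (u - v) = s"
    using assms by (auto simp: has_weights_def)
  have neg: "v - u = - (u - v)" using uv by (auto intro!: eq_vecI)
  have "a \<cdot>\<^sub>v u + b \<cdot>\<^sub>v v = b \<cdot>\<^sub>v v + a \<cdot>\<^sub>v u" for a b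
    using uv by (auto intro!: eq_vecI)
  then have "C = span2 v u" unfolding uv(3) by (intro span2_eqI) metis+
  moreover have "hamming_weight (v + u) = r" "hamming_weight (v - u) = s"
    using uv comm_add_vec[of u n v] by (simp_all add: neg hamming_weight_uminus)
  ultimately show "has_weights n C q p r s"
    unfolding has_weights_def using uv by metis
  have "a \<cdot>\<^sub>v u + b \<cdot>\<^sub>v v = a \<cdot>\<^sub>v u + (- b) \<cdot>\<^sub>v (- v)" "a \<cdot>\<^sub>v u + b \<cdot>\<^sub>v (- v) = a \<cdot>\<^sub>v u + (- b) \<cdot>\<^sub>v v" for a b
    using uv by (auto intro!: eq_vecI)
  then have "C = span2 u (- v)" unfolding uv(3) by (intro span2_eqI) metis+
  moreover have "u + - v = u - v" "u - - v = u + v" using uv by (auto intro!: eq_vecI)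
  moreover have "- v \<in> carrier_vec n" using uv by simp
  ultimately show "has_weights n C p q s r"
    unfolding has_weights_def using uv hamming_weight_uminus[of v] by metis
  have "a \<cdot>\<^sub>v u + b \<cdot>\<^sub>v v = (b - a) \<cdot>\<^sub>v (- u) + b \<cdot>\<^sub>v (u + v)"
    "a \<cdot>\<^sub>v (- u) + b \<cdot>\<^sub>v (u + v) = (b - a) \<cdot>\<^sub>v u + b \<cdot>\<^sub>v v" for a b
    using uv by (auto intro!: eq_vecI simp: algebra_simps)
  then have "C = span2 (- u) (u + v)" unfolding uv(3) by (intro span2_eqI) metis+
  moreover have "- u + (u + v) = v" using uv by (auto intro!: eq_vecI)
  moreover have "- u - (u + v) = u - v"
  proof (rule eq_vecI)
    fix i assume "i < dim_vec (u - v)"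
    then have "(- u - (u + v)) $ i = (u - v) $ i - 3 * u $ i" using uv by simp
    then show "(- u - (u + v)) $ i = (u - v) $ i" by simp
  qed (use uv in simp)
  moreover have "- u \<in> carrier_vec n" "u + v \<in> carrier_vec n" using uv by simp_all
  ultimately show "has_weights n C p r q s"
    unfolding has_weights_def using uv hamming_weight_uminus[of u] by metis
qed

lemma sort_by_adjacent_swaps:
  fixes P :: "nat \<Rightarrow> nat \<Rightarrow> nat \<Rightarrow> nat \<Rightarrow> bool"
  assumes sw: "\<And>p q r s. P p q r s \<Longrightarrow> P q p r s" "\<And>p q r s. P p q r s \<Longrightarrow> P p r q s"
    "\<And>p q r s. P p q r s \<Longrightarrow> P p q s r"
    and "P p q r s"
  shows "\<exists>p q r s. P p q r s \<and> p \<ge> q \<and> q \<ge> r \<and> r \<ge> s"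
proof -
  obtain p q r s where "P p q r s" "r \<ge> s"
    using assms(4) sw(3) by (metis nle_le)
  then obtain p q r s where "P p q r s" "q \<ge> r" "q \<ge> s"
    using sw(2) by (metis nle_le order_trans)
  then obtain p q r s where "P p q r s" "p \<ge> q" "p \<ge> r" "p \<ge> s"
    using sw(1) by (metis nle_le order_trans)
  then obtain q r s where "P p q r s" "p \<ge> q" "p \<ge> r" "p \<ge> s" "r \<ge> s"
    using sw(3) by (metis nle_le)
  then obtain q r s where "P p q r s" "p \<ge> q" "q \<ge> r" "q \<ge> s"
    using sw(2) by (metis nle_le order_trans)
  then show ?thesis using sw(3) by (metis nle_le)
qed

lemma has_weights_sum:
  assumes "has_weights n C p q r s"
  shows "\<exists>k\<le>n. p + q + r + s = 3 * k"
proof -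
  obtain u v where uv: "u \<in> carrier_vec n" "v \<in> carrier_vec n" "C = span2 u v"
    "hamming_weight u = p" "hamming_weight v = q" "hamming_weight (u + v) = r" "hamming_weight (u - v) = s"
    using assms by (auto simp: has_weights_def)
  have "card {i. i < n \<and> (u $ i \<noteq> 0 \<or> v $ i \<noteq> 0)} \<le> card {..<n}" by (intro card_mono) auto
  then show ?thesis using hamming_weight_sum_four[OF uv(1,2)] uv by auto
qed

lemma has_weights_le:
  assumes "has_weights n C p q r s"
  shows "p \<le> n" "q \<le> n" "r \<le> n" "s \<le> n"
  using assms by (auto simp: has_weights_def intro!: hamming_weight_le)

lemma dual_distance_ge_2_iff:
  assumes "n \<ge> 3" "has_weights n C p q r s"
  shows "dual_distance n C \<ge> 2 \<longleftrightarrow> p + q + r + s = 3 * n"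
proof -
  obtain u v where uv: "u \<in> carrier_vec n" "v \<in> carrier_vec n" "C = span2 u v"
    "hamming_weight u = p" "hamming_weight v = q" "hamming_weight (u + v) = r" "hamming_weight (u - v) = s"
    using assms by (auto simp: has_weights_def)
  let ?S = "{i. i < n \<and> (u $ i \<noteq> 0 \<or> v $ i \<noteq> 0)}"
  have "p + q + r + s = 3 * n \<longleftrightarrow> card ?S = card {..<n}"
    using hamming_weight_sum_four[OF uv(1,2)] unfolding uv(4-7) by simp
  also have "\<dots> \<longleftrightarrow> ?S = {..<n}"
    using card_subset_eq[of "{..<n}" ?S] by (metis (no_types, lifting) finite_lessThan lessThan_iff mem_Collect_eq subsetI)
  also have "\<dots> \<longleftrightarrow> (\<forall>i<n. u $ i \<noteq> 0 \<or> v $ i \<noteq> 0)" by auto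
  finally show ?thesis using dual_distance_span2_ge_2_iff[OF assms(1) uv(1,2)] uv by simp
qed

lemma has_positive_weightsE:
  assumes "has_weights n C p q r s" "p > 0" "q > 0" "r > 0" "s > 0"
  obtains u v where "indep2 n u v" "C = span2 u v"
    "hamming_weight u = p" "hamming_weight v = q" "hamming_weight (u + v) = r" "hamming_weight (u - v) = s"
proof -
  obtain u v where uv: "u \<in> carrier_vec n" "v \<in> carrier_vec n" "C = span2 u v"
    "hamming_weight u = p" "hamming_weight v = q" "hamming_weight (u + v) = r" "hamming_weight (u - v) = s"
    using assms(1) by (auto simp: has_weights_def)
  moreover have "indep2 n u v" unfolding indep2_iff[OF uv(1,2)] using uv assms by simp
  ultimately show ?thesis using that by blast
qed

lemma positive_weights_code:
  assumes "has_weights n C p q r s" "p > 0" "q > 0" "r > 0" "s > 0"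
  shows "linear_code n 2 C" "min_weight n C = Min {p, q, r, s}"
    "hamming_weight ` (C - {0\<^sub>v n}) = {p, q, r, s}"
    "LCD n C \<longleftrightarrow> pair_sum p q r s mod 3 \<noteq> 0"
proof -
  obtain u v where uv: "indep2 n u v" "C = span2 u v"
    "hamming_weight u = p" "hamming_weight v = q" "hamming_weight (u + v) = r" "hamming_weight (u - v) = s"
    using has_positive_weightsE[OF assms] .
  show "linear_code n 2 C" using uv(1,2) linear_code_2_iff by blast
  show "min_weight n C = Min {p, q, r, s}" using min_weight_span2[OF uv(1)] uv by simp
  show "hamming_weight ` (C - {0\<^sub>v n}) = {p, q, r, s}" using weights_span2[OF uv(1)] uv by simp
  show "LCD n C \<longleftrightarrow> pair_sum p q r s mod 3 \<noteq> 0" using LCD_span2_iff[OF uv(1)] uv by simp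
qed

lemma linear_code_2_weights:
  assumes "linear_code n 2 C"
  obtains p q r s where "has_weights n C p q r s" "p \<ge> q" "q \<ge> r" "r \<ge> s" "s > 0"
proof -
  let ?P = "\<lambda>p q r s. has_weights n C p q r s \<and> p > 0 \<and> q > 0 \<and> r > 0 \<and> s > 0"
  obtain u v where uv: "indep2 n u v" "C = span2 u v" using assms linear_code_2_iff by auto
  then have car: "u \<in> carrier_vec n" "v \<in> carrier_vec n" by (auto simp: indep2_def)
  have "?P (hamming_weight u) (hamming_weight v) (hamming_weight (u + v)) (hamming_weight (u - v))"
    using uv car indep2_iff[OF car] unfolding has_weights_def by blast
  then have "\<exists>p q r s. ?P p q r s \<and> p \<ge> q \<and> q \<ge> r \<and> r \<ge> s"
    by (intro sort_by_adjacent_swaps[of ?P]) (auto intro: has_weights_change_basis)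
  then show ?thesis using that by blast
qed

text \<open>Blocks of \<open>n - p\<close>, \<open>n - q\<close>, \<open>n - r\<close> and \<open>n - s\<close> columns at the four projective points give the
  four words their prescribed numbers of zeros; the sum condition makes these blocks fill \<open>n\<close> columns.\<close>

lemma ex_code_with_weights:
  assumes sum: "p + q + r + s = 3 * n" and le: "p \<le> n" "q \<le> n" "r \<le> n" "s \<le> n"
  shows "\<exists>C. has_weights n C p q r s"
proof -
  define i1 i2 i3 where "i1 = n - p" and "i2 = i1 + (n - q)" and "i3 = i2 + (n - r)"
  have ord: "i1 \<le> i2" "i2 \<le> i3" "i3 \<le> n" "n - i3 = n - s" and qr: "n - (i2 - i1) = q" "n - (i3 - i2) = r"
    using sum le by (auto simp: i1_def i2_def i3_def)
  define u :: "F3 vec" where "u = vec n (\<lambda>i. if i < i1 then 0 else 1)"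
  define v :: "F3 vec" where
    "v = vec n (\<lambda>i. if i < i1 then 1 else if i < i2 then 0 else if i < i3 then -1 else 1)"
  have wt: "hamming_weight w = n - card A"
    if "w \<in> carrier_vec n" "A \<subseteq> {..<n}" "\<And>i. i < n \<Longrightarrow> w $ i = 0 \<longleftrightarrow> i \<in> A" for w A
  proof -
    have "{i. i < n \<and> w $ i = 0} = A" using that by auto
    then show ?thesis using card_zeros[OF that(1)] hamming_weight_le[OF that(1)] by auto
  qed
  have "hamming_weight u = n - card {..<i1}"
    by (rule wt) (use ord in \<open>auto simp: u_def v_def split: if_splits\<close>)
  then have "hamming_weight u = p" using ord qr le i1_def by simp
  moreover have "hamming_weight v = n - card {i1..<i2}"
    by (rule wt) (use ord in \<open>auto simp: u_def v_def split: if_splits\<close>)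
  then have "hamming_weight v = q" using ord qr le i1_def by simp
  moreover have "hamming_weight (u + v) = n - card {i2..<i3}"
    by (rule wt) (use ord in \<open>auto simp: u_def v_def split: if_splits\<close>)
  then have "hamming_weight (u + v) = r" using ord qr le i1_def by simp
  moreover have "hamming_weight (u - v) = n - card {i3..<n}"
    by (rule wt) (use ord in \<open>auto simp: u_def v_def split: if_splits\<close>)
  then have "hamming_weight (u - v) = s" using ord qr le i1_def by simp
  moreover have "u \<in> carrier_vec n" "v \<in> carrier_vec n" by (simp_all add: u_def v_def)
  ultimately have "has_weights n (span2 u v) p q r s"
    unfolding has_weights_def by blast
  then show ?thesis by blast
qed

section \<open>Counting classes by their excesses\<close>

text \<open>The candidates for the amounts by which the three larger of the four weights exceed the minimum weight
  \<open>d\<close> of an LCD code without zero columns. The bound on \<open>a\<close> expresses that no weight exceeds \<open>n\<close>.\<close>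

definition excesses :: "nat \<Rightarrow> nat \<Rightarrow> (nat \<times> nat \<times> nat) set" where
  "excesses n d = {(a, b, c). c \<le> b \<and> b \<le> a \<and> a + d \<le> n \<and> a + b + c + 4 * d = 3 * n
     \<and> (a * b + a * c + b * c) mod 3 \<noteq> 0}"

text \<open>All terms that involve \<open>d\<close> are multiples of 3.\<close>

lemma pair_sum_excess:
  "pair_sum (d + a) (d + b) (d + c) d mod 3 = (a * b + a * c + b * c) mod 3"
proof -
  have "pair_sum (d + a) (d + b) (d + c) d = a * b + a * c + b * c + 3 * (d * (a + b + c) + 2 * d * d)"
    by (simp add: pair_sum_def algebra_simps)
  then show ?thesis by (simp only: mod_mult_self2)
qed

text \<open>The number \<open>k\<close> of nonzero columns is left open so that the lemma also applies to codes with zero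
  columns, which compete for the maximum in \<open>d3\<close>.\<close>

lemma LCD_code_excess:
  assumes "linear_code_dist n 2 d C" "LCD n C"
  obtains a b c k where "d > 0" "k \<le> n" "has_weights n C (d + a) (d + b) (d + c) d" "c \<le> b" "b \<le> a"
    "a + b + c + 4 * d = 3 * k" "(a * b + a * c + b * c) mod 3 \<noteq> 0"
proof -
  obtain p q r s where w: "has_weights n C p q r s" "p \<ge> q" "q \<ge> r" "r \<ge> s" "s > 0"
    using assms linear_code_2_weights[of n C] unfolding linear_code_dist_def by blast
  have pos: "p > 0" "q > 0" "r > 0" using w by auto
  have "Min {p, q, r, s} = s" using w by (intro Min_eqI) auto
  then have s: "s = d"
    using positive_weights_code(2)[OF w(1) pos w(5)] assms by (simp add: linear_code_dist_def)
  obtain k where k: "k \<le> n" "p + q + r + s = 3 * k" using has_weights_sum[OF w(1)] by auto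
  have "pair_sum p q r s mod 3 \<noteq> 0"
    using positive_weights_code(4)[OF w(1) pos w(5)] assms by simp
  moreover have "r - d \<le> q - d" "q - d \<le> p - d" using w by (auto intro: diff_le_mono)
  ultimately show ?thesis
    using that[of k "p - d" "q - d" "r - d"] w k s pair_sum_excess[of d "p - d" "q - d" "r - d"] by simp
qed

definition full_LCD_codes :: "nat \<Rightarrow> nat \<Rightarrow> F3 vec set set" where
  "full_LCD_codes n d = {C. linear_code_dist n 2 d C \<and> LCD n C \<and> dual_distance n C \<ge> 2}"

lemma excess_LCD_code:
  assumes "has_weights n C (d + a) (d + b) (d + c) d" "d > 0" "(a * b + a * c + b * c) mod 3 \<noteq> 0"
  shows "linear_code_dist n 2 d C" "LCD n C"
proof -
  have pos: "d + a > 0" "d + b > 0" "d + c > 0" using assms(2) by simp_all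
  have "Min {d + a, d + b, d + c, d} = d" by (intro Min_eqI) auto
  then show "linear_code_dist n 2 d C"
    using positive_weights_code(1,2)[OF assms(1) pos assms(2)] by (simp add: linear_code_dist_def)
  show "LCD n C"
    using positive_weights_code(4)[OF assms(1) pos assms(2)] assms(3) by (simp add: pair_sum_excess)
qed

lemma full_LCD_codes_iff:
  assumes "n \<ge> 3" "d > 0"
  shows "C \<in> full_LCD_codes n d \<longleftrightarrow>
    (\<exists>(a, b, c)\<in>excesses n d. has_weights n C (d + a) (d + b) (d + c) d)"
proof
  assume "C \<in> full_LCD_codes n d"
  then have C: "linear_code_dist n 2 d C" "LCD n C" "dual_distance n C \<ge> 2"
    by (auto simp: full_LCD_codes_def)
  obtain a b c k where "d > 0" "k \<le> n"
    and w: "has_weights n C (d + a) (d + b) (d + c) d" "c \<le> b" "b \<le> a"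
      "a + b + c + 4 * d = 3 * k" "(a * b + a * c + b * c) mod 3 \<noteq> 0"
    using LCD_code_excess[OF C(1,2)] .
  have "a + b + c + 4 * d = 3 * n"
    using dual_distance_ge_2_iff[OF assms(1) w(1)] C(3) by simp
  moreover have "a + d \<le> n" using has_weights_le(1)[OF w(1)] by simp
  ultimately have "(a, b, c) \<in> excesses n d" using w by (simp add: excesses_def)
  then show "\<exists>(a, b, c)\<in>excesses n d. has_weights n C (d + a) (d + b) (d + c) d" using w by blast
next
  assume "\<exists>(a, b, c)\<in>excesses n d. has_weights n C (d + a) (d + b) (d + c) d"
  then obtain a b c where e: "(a, b, c) \<in> excesses n d"
    and w: "has_weights n C (d + a) (d + b) (d + c) d" by blast
  then show "C \<in> full_LCD_codes n d"
    using excess_LCD_code[OF w assms(2)] dual_distance_ge_2_iff[OF assms(1) w]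
    by (simp add: full_LCD_codes_def excesses_def)
qed

text \<open>The set of weights of the code determines the excesses up to multiplicities. The largest excess is
  determined by it, and the fixed sum settles the multiplicities of the other two.\<close>

lemma excess_unique:
  assumes "(a, b, c) \<in> excesses n d" "(a', b', c') \<in> excesses n d" "d > 0"
    and "has_weights n C (d + a) (d + b) (d + c) d" "has_weights n C (d + a') (d + b') (d + c') d"
  shows "(a, b, c) = (a', b', c')"
proof -
  have set_eq: "{d + a, d + b, d + c, d} = {d + a', d + b', d + c', d}"
    using positive_weights_code(3)[OF assms(4)] positive_weights_code(3)[OF assms(5)] assms(3) by simp
  have ord: "c \<le> b" "b \<le> a" "c' \<le> b'" "b' \<le> a'" "a + b + c = a' + b' + c'"
    using assms(1,2) by (auto simp: excesses_def)
  have "d + a \<in> {d + a', d + b', d + c', d}" "d + a' \<in> {d + a, d + b, d + c, d}"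
    using set_eq by blast+
  then have "a = a'" using ord by auto
  moreover have "d + b \<in> {d + a', d + b', d + c', d}" "d + b' \<in> {d + a, d + b, d + c, d}"
    "d + c \<in> {d + a', d + b', d + c', d}" "d + c' \<in> {d + a, d + b, d + c, d}"
    using set_eq by blast+
  then have "b = b'" using ord \<open>a = a'\<close> by auto
  ultimately show ?thesis using ord by simp
qed

text \<open>Each class of codes consists of all codes with a given tuple of excesses. Such a class is nonempty by
  \<open>ex_code_with_weights\<close>, closed under equivalence by \<open>has_weights_equiv\<close> and a single class by
  \<open>equiv_of_weights\<close>.\<close>

theorem num_inequivalent_full_LCD_codes:
  assumes n: "n \<ge> 3" and d: "d > 0"
  shows "num_inequivalent n (full_LCD_codes n d) = card (excesses n d)"
proof -
  define cls where
    "cls = (\<lambda>(a, b, c). {C. has_weights n C (d + a) (d + b) (d + c) d})"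
  have equiv_class: "code_equiv n `` {C} = cls t" if "t \<in> excesses n d" "C \<in> cls t" for t C
  proof -
    obtain a b c where t: "t = (a, b, c)" by (cases t)
    have "(d + a) + (d + b) + (d + c) + d = 3 * n" using that(1) by (simp add: t excesses_def)
    moreover have C: "has_weights n C (d + a) (d + b) (d + c) d" using that(2) by (simp add: cls_def t)
    ultimately have "(C, D) \<in> code_equiv n \<longleftrightarrow> has_weights n D (d + a) (d + b) (d + c) d" for D
      using has_weights_equiv[OF C] equiv_of_weights[OF C] by blast
    then show ?thesis by (simp add: cls_def t Image_def)
  qed
  have nonempty: "cls t \<noteq> {}" if "t \<in> excesses n d" for t
  proof -
    obtain a b c where t: "t = (a, b, c)" by (cases t)
    have "\<exists>C. has_weights n C (d + a) (d + b) (d + c) d"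
      by (rule ex_code_with_weights) (use that in \<open>auto simp: t excesses_def\<close>)
    then show ?thesis by (simp add: cls_def t)
  qed
  have mem: "C \<in> full_LCD_codes n d \<longleftrightarrow> (\<exists>t\<in>excesses n d. C \<in> cls t)" for C
    unfolding full_LCD_codes_iff[OF n d] by (auto simp: cls_def)
  have "full_LCD_codes n d // code_equiv n = cls ` excesses n d"
  proof
    show "full_LCD_codes n d // code_equiv n \<subseteq> cls ` excesses n d"
      using mem equiv_class by (auto simp: quotient_def)
    show "cls ` excesses n d \<subseteq> full_LCD_codes n d // code_equiv n"
    proof
      fix K assume "K \<in> cls ` excesses n d"
      then obtain t where t: "t \<in> excesses n d" "K = cls t" by blast
      then obtain C where "C \<in> cls t" using nonempty by blast
      then show "K \<in> full_LCD_codes n d // code_equiv n"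
        using t mem equiv_class quotientI by metis
    qed
  qed
  moreover have "inj_on cls (excesses n d)"
  proof (rule inj_onI)
    fix s t assume st: "s \<in> excesses n d" "t \<in> excesses n d" "cls s = cls t"
    then obtain C where "C \<in> cls s" "C \<in> cls t" using nonempty by blast
    then show "s = t"
      using st(1,2) excess_unique[OF _ _ d] by (cases s; cases t) (auto simp: cls_def)
  qed
  ultimately show ?thesis unfolding num_inequivalent_def by (simp add: card_image)
qed

section \<open>Optimal codes\<close>

text \<open>No code of larger minimum weight is LCD if every excess triple that such a code could have, with any
  number \<open>k\<close> of nonzero columns, makes the second symmetric function vanish modulo 3.\<close>

lemma d3_eq:
  assumes d: "d > 0" and ex: "excesses n d \<noteq> {}"
    and max: "\<And>e a b c k. e > d \<Longrightarrow> k \<le> n \<Longrightarrow> a + b + c + 4 * e = 3 * k \<Longrightarrow>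
      (a * b + a * c + b * c) mod 3 = 0"
  shows "d3 n 2 = d"
proof -
  let ?D = "{e. \<exists>C. linear_code_dist n 2 e C \<and> LCD n C}"
  have le: "e \<le> d" if "e \<in> ?D" for e
  proof (rule ccontr)
    assume "\<not> e \<le> d"
    from that obtain C where "linear_code_dist n 2 e C" "LCD n C" by blast
    then obtain a b c k where "e > 0" "k \<le> n" "has_weights n C (e + a) (e + b) (e + c) e" "c \<le> b" "b \<le> a"
      "a + b + c + 4 * e = 3 * k" "(a * b + a * c + b * c) mod 3 \<noteq> 0"
      by (rule LCD_code_excess)
    then show False using max[of e k a b c] \<open>\<not> e \<le> d\<close> by simp
  qed
  obtain a b c where e: "(a, b, c) \<in> excesses n d" using ex by auto
  have "\<exists>C. has_weights n C (d + a) (d + b) (d + c) d"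
    by (rule ex_code_with_weights) (use e in \<open>auto simp: excesses_def\<close>)
  then obtain C where "has_weights n C (d + a) (d + b) (d + c) d" by blast
  then have "d \<in> ?D" using excess_LCD_code d e unfolding excesses_def by blast
  moreover have "finite ?D" using le by (auto intro: finite_subset[of _ "{..d}"])
  ultimately show ?thesis unfolding d3_def using le by (intro Max_eqI) auto
qed

lemma num_inequivalent_optimal:
  assumes "n \<ge> 3" "d > 0" "excesses n d \<noteq> {}"
    and "\<And>e a b c k. e > d \<Longrightarrow> k \<le> n \<Longrightarrow> a + b + c + 4 * e = 3 * k \<Longrightarrow>
      (a * b + a * c + b * c) mod 3 = 0"
  shows "num_inequivalent n {C. optimal_LCD n 2 C \<and> dual_distance n C \<ge> 2} = card (excesses n d)"
  using num_inequivalent_full_LCD_codes[OF assms(1,2)] d3_eq[OF assms(2-4)]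
  by (simp add: optimal_LCD_def full_LCD_codes_def conj_assoc)

lemma partitions_of_2:
  assumes "c \<le> b" "b \<le> a" "a + b + c = (2::nat)"
  shows "(a, b, c) \<in> {(2, 0, 0), (1, 1, 0)}"
  using assms by simp presburger

lemma partitions_of_3:
  assumes "c \<le> b" "b \<le> a" "a + b + c = (3::nat)"
  shows "(a, b, c) \<in> {(3, 0, 0), (2, 1, 0), (1, 1, 1)}"
  using assms by simp presburger

lemma partitions_of_4:
  assumes "c \<le> b" "b \<le> a" "a + b + c = (4::nat)"
  shows "(a, b, c) \<in> {(4, 0, 0), (3, 1, 0), (2, 2, 0), (2, 1, 1)}"
  using assms by simp presburger

lemma partitions_of_5:
  assumes "c \<le> b" "b \<le> a" "a + b + c = (5::nat)"
  shows "(a, b, c) \<in> {(5, 0, 0), (4, 1, 0), (3, 2, 0), (3, 1, 1), (2, 2, 1)}"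
  using assms by simp presburger

lemma excesses_4s:
  assumes "s \<ge> 1"
  shows "excesses (4 * s) (3 * s - 1) = {(2, 2, 0), (2, 1, 1)}"
proof (intro equalityI subsetI)
  fix t assume "t \<in> excesses (4 * s) (3 * s - 1)"
  moreover obtain a b c where t: "t = (a, b, c)" by (cases t)
  ultimately have abc: "c \<le> b" "b \<le> a" "a + b + c = 4"
    and nz: "(a * b + a * c + b * c) mod 3 \<noteq> 0"
    using assms by (auto simp: excesses_def)
  show "t \<in> {(2, 2, 0), (2, 1, 1)}"
    using partitions_of_4[OF abc] nz t by auto
qed (use assms in \<open>auto simp: excesses_def\<close>)

lemma excesses_4s_plus_1:
  assumes "s \<ge> 1"
  shows "excesses (4 * s + 1) (3 * s) = {(2, 1, 0)}"
proof (intro equalityI subsetI)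
  fix t assume "t \<in> excesses (4 * s + 1) (3 * s)"
  moreover obtain a b c where t: "t = (a, b, c)" by (cases t)
  ultimately have abc: "c \<le> b" "b \<le> a" "a + b + c = 3"
    and nz: "(a * b + a * c + b * c) mod 3 \<noteq> 0"
    by (auto simp: excesses_def)
  show "t \<in> {(2, 1, 0)}"
    using partitions_of_3[OF abc] nz t by auto
qed (use assms in \<open>auto simp: excesses_def\<close>)

lemma excesses_4s_plus_2: "excesses (4 * s + 2) (3 * s + 1) = {(1, 1, 0)}"
proof (intro equalityI subsetI)
  fix t assume "t \<in> excesses (4 * s + 2) (3 * s + 1)"
  moreover obtain a b c where t: "t = (a, b, c)" by (cases t)
  ultimately have abc: "c \<le> b" "b \<le> a" "a + b + c = 2"
    and nz: "(a * b + a * c + b * c) mod 3 \<noteq> 0"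
    by (auto simp: excesses_def)
  show "t \<in> {(1, 1, 0)}"
    using partitions_of_2[OF abc] nz t by auto
qed (auto simp: excesses_def)

lemma excesses_4s_plus_3:
  assumes "s \<ge> 2"
  shows "excesses (4 * s + 3) (3 * s + 1) = {(4, 1, 0), (3, 1, 1), (2, 2, 1)}"
proof (intro equalityI subsetI)
  fix t assume "t \<in> excesses (4 * s + 3) (3 * s + 1)"
  moreover obtain a b c where t: "t = (a, b, c)" by (cases t)
  ultimately have abc: "c \<le> b" "b \<le> a" "a + b + c = 5"
    and nz: "(a * b + a * c + b * c) mod 3 \<noteq> 0"
    by (auto simp: excesses_def)
  show "t \<in> {(4, 1, 0), (3, 1, 1), (2, 2, 1)}"
    using partitions_of_5[OF abc] nz t by auto
qed (use assms in \<open>auto simp: excesses_def\<close>)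

text \<open>This excludes minimum weights too close to the averaging bound \<open>3 n / 4\<close>, where the total excess
  is at most 1.\<close>

lemma pair_products_zero:
  assumes "a + b + c \<le> (1::nat)"
  shows "(a * b + a * c + b * c) mod 3 = 0"
proof -
  have "a = 0 \<and> b = 0 \<or> a = 0 \<and> c = 0 \<or> b = 0 \<and> c = 0" using assms by linarith
  then show ?thesis by auto
qed

theorem proposition7p5:
  shows "(\<forall>s\<ge>1. num_inequivalent (4 * s)
            {C. optimal_LCD (4 * s) 2 C \<and> dual_distance (4 * s) C \<ge> 2} = 2) \<and>
         (\<forall>t\<in>{1, 2}. \<forall>s\<ge>1. num_inequivalent (4 * s + t)
            {C. optimal_LCD (4 * s + t) 2 C \<and> dual_distance (4 * s + t) C \<ge> 2} = 1) \<and>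
         (\<forall>s\<ge>2. num_inequivalent (4 * s + 3)
            {C. optimal_LCD (4 * s + 3) 2 C \<and> dual_distance (4 * s + 3) C \<ge> 2} = 3)"
proof (intro conjI allI ballI impI)
  fix s :: nat assume s: "s \<ge> 1"
  show "num_inequivalent (4 * s) {C. optimal_LCD (4 * s) 2 C \<and> dual_distance (4 * s) C \<ge> 2} = 2"
  proof (subst num_inequivalent_optimal[where d = "3 * s - 1"])
    show "(a * b + a * c + b * c) mod 3 = 0"
      if "e > 3 * s - 1" "k \<le> 4 * s" "a + b + c + 4 * e = 3 * k" for e a b c k
      by (rule pair_products_zero) (use that in linarith)
  qed (use s in \<open>simp_all only: excesses_4s, simp_all\<close>)
next
  fix s t :: nat assume t: "t \<in> {1, 2}" and s: "s \<ge> 1"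
  have 1: "num_inequivalent (4 * s + 1)
      {C. optimal_LCD (4 * s + 1) 2 C \<and> dual_distance (4 * s + 1) C \<ge> 2} = 1"
  proof (subst num_inequivalent_optimal[where d = "3 * s"])
    show "(a * b + a * c + b * c) mod 3 = 0"
      if "e > 3 * s" "k \<le> 4 * s + 1" "a + b + c + 4 * e = 3 * k" for e a b c k
      by (rule pair_products_zero) (use that in linarith)
  qed (use s in \<open>simp_all only: excesses_4s_plus_1, simp_all\<close>)
  have 2: "num_inequivalent (4 * s + 2)
      {C. optimal_LCD (4 * s + 2) 2 C \<and> dual_distance (4 * s + 2) C \<ge> 2} = 1"
  proof (subst num_inequivalent_optimal[where d = "3 * s + 1"])
    show "(a * b + a * c + b * c) mod 3 = 0"
      if "e > 3 * s + 1" "k \<le> 4 * s + 2" "a + b + c + 4 * e = 3 * k" for e a b c k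
      by (rule pair_products_zero) (use that in linarith)
  qed (use s in \<open>simp_all only: excesses_4s_plus_2, simp_all\<close>)
  show "num_inequivalent (4 * s + t)
      {C. optimal_LCD (4 * s + t) 2 C \<and> dual_distance (4 * s + t) C \<ge> 2} = 1"
    using t 1 2 by auto
next
  fix s :: nat assume s: "s \<ge> 2"
  show "num_inequivalent (4 * s + 3)
      {C. optimal_LCD (4 * s + 3) 2 C \<and> dual_distance (4 * s + 3) C \<ge> 2} = 3"
  proof (subst num_inequivalent_optimal[where d = "3 * s + 1"])
    show "(a * b + a * c + b * c) mod 3 = 0"
      if "e > 3 * s + 1" "k \<le> 4 * s + 3" "a + b + c + 4 * e = 3 * k" for e a b c k
      by (rule pair_products_zero) (use that in linarith)
  qed (use s in \<open>simp_all only: excesses_4s_plus_3, simp_all\<close>)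
qed

end
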